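(* Let $T=(T_\omega)_{\omega\in\Sigma_I^+}$ be a conformal Smale skew-product endomorphism with alphabet $I=\mathbb{N}^*\times\mathbb{N}^*$ and fiber space $Y\subset\mathbb{C}$, with fiber limit sets $J_{T,\omega}$, $\omega\in\Sigma_I^+$. Then the Hausdorff dimension $HD(J_{T,\omega})$ does not depend on $\omega\in\Sigma_I^+$.
   Context: **Shift spaces.** $\mathbb{N}^*=\{1,2,\dots\}$, $I=\mathbb{N}^*\times\mathbb{N}^*$. $\Sigma_I=I^{\mathbb{Z}}$ and $\Sigma_I^+=I^{\{0,1,2,\dots\}}$, with left shift $\sigma$ on both. For $\tau\in\Sigma_I$, $\tau|_m^\infty=\tau_m\tau_{m+1}\dots$ is regarded as an element of $\Sigma_I^+$ (reindexed from $0$). For $\omega\in\Sigma_I^+$, $[\omega]=\{\tau\in\Sigma_I:\tau|_0^\infty=\omega\}$; for $a\in I$, $a\omega$ is the concatenation. A function $\psi:\Sigma_I\to\mathbb{R}$ is Hölder continuous if there are $C,\beta>0$ such that $|\psi(\eta)-\psi(\xi)|\le Ce^{-\beta n}$ whenever $n\ge0$ and $\eta_k=\xi_k$ for all $|k|\le n$. **Conformal Smale skew-products.** $Y\subset\mathbb{C}$ is the closure of a bounded open set, with nonempty interior. A conformal Smale skew-product endomorphism is a map $T:\Sigma_I^+\times Y\to\Sigma_I^+\times Y$, $T(\omega,y)=(\sigma(\omega),T_\omega(y))$, such that: (a) each $T_\omega:Y\to Y$ is continuous and injective; (b) each $T_\omega$ extends to a $C^1$ conformal embedding (also denoted $T_\omega$)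 $Y^*\to Y^*$, where $Y^*$ is a bounded connected open subset of $\mathbb{C}$ containing $Y$; (c) there is $\lambda>1$ with $|T_\omega(y_2)-T_\omega(y_1)|\le\lambda^{-1}|y_2-y_1|$ for all $\omega\in\Sigma_I^+$, $y_1,y_2\in Y^*$; (d) there are $\alpha>0$, $H>0$ with $\big|\log|T_\omega'(y)|-\log|T_\omega'(z)|\big|\le H|y-z|^\alpha$ for all $\omega\in\Sigma_I^+$, $y,z\in Y^*$; (e) the map $\Sigma_I\ni\tau\mapsto\log|T'_{\tau|_0^\infty}(\hat\pi_2(\tau))|$ is Hölder continuous, where $\hat\pi_2:\Sigma_I\to Y$ sends $\tau$ to the unique point of $\bigcap_{n\ge1}\overline{T_{\tau|_{-1}^\infty}\circ T_{\tau|_{-2}^\infty}\circ\cdots\circ T_{\tau|_{-n}^\infty}(Y)}$; (f) for all $\omega\in\Sigma_I^+$ and $a\ne b$ in $I$, $T_{a\omega}(\mathrm{Int}\,Y)\cap T_{b\omega}(\mathrm{Int}\,Y)=\emptyset$; (g) there is a measurable $\delta:\Sigma_I^+\to(0,\infty)$ such that for every $\omega\in\Sigma_I^+$, $J_{T,\omega}\cap(Y\setminus\overline{B}(Y^c,\delta(\omega)))\neq\emptyset$, where $J_{T,\omega}:=\hat\pi_2([\omega])\subset\mathbb{C}$ (the fiber limit set) and $\overline B(Y^c,\delta)$ is the closed $\delta$-neighbourhood of the complement of $Y$. $HD$ denotes Hausdorff dimension. *)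

theory Defs
  imports "HOL-Analysis.Analysis"
begin

section \<open>Hausdorff measure and Hausdorff dimension\<close>

text \<open>
  The weight of a covering set is \<open>diam(E)\<close> to the power \<open>s\<close>, where a nonempty set has weight 1
  for \<open>s = 0\<close>; the case distinction is needed because \<open>0 powr 0 = 0\<close> here. Covering sets are
  required to be bounded because \<^const>\<open>diameter\<close> is only meaningful for bounded sets.
\<close>

definition hausdorff_weight :: "real \<Rightarrow> 'a::metric_space set \<Rightarrow> ennreal" where
  "hausdorff_weight s E =
     (if E = {} then 0 else if s = 0 then 1 else ennreal (diameter E powr s))"

definition hausdorff_premeasure :: "real \<Rightarrow> real \<Rightarrow> 'a::metric_space set \<Rightarrow> ennreal" where
  "hausdorff_premeasure s d A =
     (INF E \<in> {E :: nat \<Rightarrow> 'a set. A \<subseteq> (\<Union>i. E i) \<and> (\<forall>i. bounded (E i) \<and> diameter (E i) \<le> d)}.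
        (\<Sum>i. hausdorff_weight s (E i)))"

definition hausdorff_measure :: "real \<Rightarrow> 'a::metric_space set \<Rightarrow> ennreal" where
  "hausdorff_measure s A = (SUP d \<in> {0<..}. hausdorff_premeasure s d A)"

definition hausdorff_dim :: "'a::metric_space set \<Rightarrow> ennreal" where
  "hausdorff_dim A = (INF s \<in> {s. 0 \<le> s \<and> hausdorff_measure s A = 0}. ennreal s)"


section \<open>Shift spaces\<close>

type_synonym letter = "nat \<times> nat"

definition alphabet :: "letter set" where
  "alphabet = {1..} \<times> {1..}"

definition two_sided_shift :: "(int \<Rightarrow> letter) set" where
  "two_sided_shift = {\<tau>. \<forall>k. \<tau> k \<in> alphabet}"

definition one_sided_shift :: "(nat \<Rightarrow> letter) set" where
  "one_sided_shift = {\<omega>. \<forall>k. \<omega> k \<in> alphabet}"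

text \<open>
  The product of the discrete sigma-algebras; as the alphabet is countable, this is the Borel
  sigma-algebra of the product topology. Its underlying space is \<^const>\<open>one_sided_shift\<close>.
\<close>

definition one_sided_shift_algebra :: "(nat \<Rightarrow> letter) measure" where
  "one_sided_shift_algebra = PiM UNIV (\<lambda>_. count_space alphabet)"

text \<open>\<open>tail_from m \<tau>\<close> is the sequence \<open>\<tau>(m) \<tau>(m+1) \<dots>\<close>, reindexed from 0.\<close>

definition tail_from :: "int \<Rightarrow> (int \<Rightarrow> letter) \<Rightarrow> (nat \<Rightarrow> letter)" where
  "tail_from m \<tau> = (\<lambda>k. \<tau> (m + int k))"

definition cylinder :: "(nat \<Rightarrow> letter) \<Rightarrow> (int \<Rightarrow> letter) set" where
  "cylinder \<omega> = {\<tau> \<in> two_sided_shift. tail_from 0 \<tau> = \<omega>}"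

definition concat_letter :: "letter \<Rightarrow> (nat \<Rightarrow> letter) \<Rightarrow> (nat \<Rightarrow> letter)" where
  "concat_letter a \<omega> = case_nat a \<omega>"

definition holder_two_sided :: "((int \<Rightarrow> letter) \<Rightarrow> real) \<Rightarrow> bool" where
  "holder_two_sided \<psi> \<longleftrightarrow>
     (\<exists>C>0. \<exists>\<beta>>0. \<forall>\<eta>\<in>two_sided_shift. \<forall>\<xi>\<in>two_sided_shift. \<forall>n::nat.
        (\<forall>k. \<bar>k\<bar> \<le> int n \<longrightarrow> \<eta> k = \<xi> k) \<longrightarrow> \<bar>\<psi> \<eta> - \<psi> \<xi>\<bar> \<le> C * exp (- \<beta> * real n))"


section \<open>Conformal embeddings of planar domains\<close>

text \<open>
  Conformality is meant in the Riemannian sense: the real derivative at each point is a similarity,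
  so both holomorphic and antiholomorphic maps are covered.
\<close>

definition C1_conformal_embedding ::
    "(complex \<Rightarrow> complex) \<Rightarrow> complex set \<Rightarrow> complex set \<Rightarrow> bool" where
  "C1_conformal_embedding f U V \<longleftrightarrow>
     f ` U \<subseteq> V \<and> (\<exists>g. homeomorphism U (f ` U) f g) \<and>
     (\<exists>f' :: complex \<Rightarrow> complex \<Rightarrow>\<^sub>L complex.
        continuous_on U f' \<and>
        (\<forall>x\<in>U. (f has_derivative blinfun_apply (f' x)) (at x) \<and>
                 (\<exists>r>0. \<forall>v. norm (blinfun_apply (f' x) v) = r * norm v)))"

text \<open>
  \<open>|f'(x)|\<close>, the similarity ratio of the derivative; for holomorphic \<open>f\<close> it is the modulus of the
  complex derivative.
\<close>

definition derivative_ratio :: "(complex \<Rightarrow> complex) \<Rightarrow> complex \<Rightarrow> real" where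
  "derivative_ratio f x = onorm (frechet_derivative f (at x))"


section \<open>Conformal Smale skew-product endomorphisms\<close>

text \<open>\<open>T(\<tau>|-1) \<circ> T(\<tau>|-2) \<circ> \<dots> \<circ> T(\<tau>|-n)\<close>, with \<open>T(\<tau>|m)\<close> short for \<open>T (tail_from m \<tau>)\<close>.\<close>

primrec fiber_composition ::
    "((nat \<Rightarrow> letter) \<Rightarrow> complex \<Rightarrow> complex) \<Rightarrow> (int \<Rightarrow> letter) \<Rightarrow> nat \<Rightarrow> complex \<Rightarrow> complex" where
  "fiber_composition T \<tau> 0 = id"
| "fiber_composition T \<tau> (Suc n) = fiber_composition T \<tau> n \<circ> T (tail_from (- int (Suc n)) \<tau>)"

definition fiber_coding ::
    "((nat \<Rightarrow> letter) \<Rightarrow> complex \<Rightarrow> complex) \<Rightarrow> complex set \<Rightarrow> (int \<Rightarrow> letter) \<Rightarrow> complex" where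
  "fiber_coding T Y \<tau> = (THE x. x \<in> (\<Inter>n\<in>{1..}. closure (fiber_composition T \<tau> n ` Y)))"

definition fiber_limit_set ::
    "((nat \<Rightarrow> letter) \<Rightarrow> complex \<Rightarrow> complex) \<Rightarrow> complex set \<Rightarrow> (nat \<Rightarrow> letter) \<Rightarrow> complex set" where
  "fiber_limit_set T Y \<omega> = fiber_coding T Y ` cylinder \<omega>"

definition closed_neighbourhood :: "complex set \<Rightarrow> real \<Rightarrow> complex set" where
  "closed_neighbourhood A d = {z. infdist z A \<le> d}"

text \<open>
  The endomorphism \<open>(\<omega>, y) \<mapsto> (\<sigma> \<omega>, T \<omega> y)\<close> is given by its family of fiber maps \<open>T\<close>.
  A fiber map and its extension from \<open>Y\<close> to \<open>Ys\<close> are one function \<open>T \<omega>\<close>; its values outside \<open>Ys\<close>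
  are irrelevant, as are those of \<open>T\<close> outside the shift space.
\<close>

locale conformal_Smale_skew_product =
  fixes Y Ys :: "complex set"
    and T :: "(nat \<Rightarrow> letter) \<Rightarrow> complex \<Rightarrow> complex"
  assumes Y_closure: "\<exists>U. open U \<and> bounded U \<and> Y = closure U"
    and Y_interior: "interior Y \<noteq> {}"
    and Ys_domain: "open Ys" "connected Ys" "bounded Ys" "Y \<subseteq> Ys"
    and T_maps: "\<And>\<omega>. \<omega> \<in> one_sided_shift \<Longrightarrow> T \<omega> ` Y \<subseteq> Y"
    and T_continuous: "\<And>\<omega>. \<omega> \<in> one_sided_shift \<Longrightarrow> continuous_on Y (T \<omega>)"
    and T_inj: "\<And>\<omega>. \<omega> \<in> one_sided_shift \<Longrightarrow> inj_on (T \<omega>) Y"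
    and T_conformal: "\<And>\<omega>. \<omega> \<in> one_sided_shift \<Longrightarrow> C1_conformal_embedding (T \<omega>) Ys Ys"
    and T_contraction:
      "\<exists>l>1. \<forall>\<omega>\<in>one_sided_shift. \<forall>y\<^sub>1\<in>Ys. \<forall>y\<^sub>2\<in>Ys.
         norm (T \<omega> y\<^sub>2 - T \<omega> y\<^sub>1) \<le> inverse l * norm (y\<^sub>2 - y\<^sub>1)"
    and T_distortion:
      "\<exists>\<alpha>>0. \<exists>H>0. \<forall>\<omega>\<in>one_sided_shift. \<forall>y\<in>Ys. \<forall>z\<in>Ys.
         \<bar>ln (derivative_ratio (T \<omega>) y) - ln (derivative_ratio (T \<omega>) z)\<bar> \<le> H * norm (y - z) powr \<alpha>"
    and T_potential:
      "holder_two_sided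
         (\<lambda>\<tau>. ln (derivative_ratio (T (tail_from 0 \<tau>)) (fiber_coding T Y \<tau>)))"
    and T_disjoint:
      "\<And>\<omega> a b. \<omega> \<in> one_sided_shift \<Longrightarrow> a \<in> alphabet \<Longrightarrow> b \<in> alphabet \<Longrightarrow> a \<noteq> b \<Longrightarrow>
         T (concat_letter a \<omega>) ` interior Y \<inter> T (concat_letter b \<omega>) ` interior Y = {}"
    and T_boundary:
      "\<exists>\<delta> \<in> borel_measurable one_sided_shift_algebra. \<forall>\<omega>\<in>one_sided_shift. (\<delta> \<omega> :: real) > 0 \<and>
         fiber_limit_set T Y \<omega> \<inter> (Y - closed_neighbourhood (- Y) (\<delta> \<omega>)) \<noteq> {}"

end

theory Submission
  imports Defs "HOL-Library.Sublist"
begin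

text \<open>
  Running the fiber maps along a finite word \<open>u\<close> prefixed to \<open>\<omega>\<close> gives a conformal map
  \<open>word_map T u \<omega>\<close>, and for each \<open>n\<close> the images of \<open>Y\<close> under these maps, over all words of length \<open>n\<close>, cover
  the fiber limit set over \<open>\<omega>\<close>. The dimension is the same in all fibers because the sizes of these
  cylinders are the same up to a constant factor. In one fiber, moving the point changes the
  derivative ratio by a bounded factor, by contraction and \<open>T_distortion\<close>
  (\<open>fixed_fiber_distortion\<close>). Replacing \<open>\<omega>\<close> by \<open>\<omega>'\<close> also costs a bounded factor, because the potential is
  Hoelder continuous and sequences with the same past agree on larger and larger windows when
  shifted to the right (\<open>cross_fiber_distortion\<close>). So the ratios are comparable, with one constant \<open>K\<close>,
  to a number \<open>word_scale u\<close> that depends on \<open>u\<close> only, and \<open>word_scale\<close> is multiplicative up to \<open>K\<close>.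

  It remains to read off the dimension from the sums of \<open>word_scale u powr s\<close> over words of length \<open>n\<close>, in
  the spirit of Bowen's formula but without pressure or conformal measures. If for one \<open>n\<close> the
  sum is at most \<open>K powr (- s) / 2\<close>, the sums over words of length \<open>n * k\<close> tend to 0 as \<open>k\<close> grows, and the
  covers by cylinders show that the \<open>s\<close>-dimensional measure of every fiber limit set is 0
  (\<open>null_if_scale_sums_small\<close>). If this fails for every \<open>n\<close>, then for \<open>r < s\<close> some finite set of words of one
  length has a sum of exponent \<open>r\<close> as large as \<open>K powr r\<close>, since scales decay exponentially in the length.
  On the tree of sequences of such words the weight \<open>word_scale u powr r\<close> is at most the total
  weight of the children, so every bar of the tree has weight at least 1
  (\<open>root_weight_le_weight_of_bar\<close>). A cover of a fiber limit set produces a bar: for each covering set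
  take the cylinders of comparable size that meet it. As these contain disjoint discs of
  comparable size, their number is bounded (\<open>card_stopping_words_bounded\<close>). Hence the
  \<open>r\<close>-dimensional measure of every fiber limit set is positive (\<open>positive_if_scale_sum_large\<close>).

  So if the \<open>r\<close>-dimensional measure vanishes in one fiber, the \<open>s\<close>-dimensional measure vanishes in all
  fibers for every \<open>s > r\<close>, which is the equality of dimensions.
\<close>

section \<open>Geometry of differentiable maps\<close>

text \<open>
  The mean value inequality needs a convex domain. On a connected open set the relation ``the
  displacement between \<open>x\<close> and \<open>y\<close> is at most a constant times \<open>d\<close>, for every \<open>f\<close> with derivative bounded
  by \<open>d\<close>'' is an equivalence relation with open classes, hence has a single class; compactness of
  \<open>A\<close> makes the constant uniform. The point is that \<open>C\<close> does not depend on \<open>f\<close>.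
\<close>

lemma displacement_bound_on_compact:
  fixes S A :: "'a::euclidean_space set"
  assumes "open S" "connected S" "compact A" "A \<subseteq> S"
  obtains C where "0 \<le> C"
    "\<And>(f::'a \<Rightarrow> 'a) d x y. \<lbrakk>\<And>z. z \<in> S \<Longrightarrow> f differentiable at z \<and> onorm (frechet_derivative f (at z)) \<le> d;
        x \<in> A; y \<in> A\<rbrakk> \<Longrightarrow> norm (f x - f y) \<le> C * d"
proof (cases "A = {}")
  case True
  then show thesis using that[of 0] by simp
next
  case False
  define bnd where "bnd = (\<lambda>(f::'a \<Rightarrow> 'a) d. \<forall>z\<in>S. f differentiable at z \<and> onorm (frechet_derivative f (at z)) \<le> d)"
  define R where "R = (\<lambda>x y. \<exists>C\<ge>0. \<forall>f d. bnd f d \<longrightarrow> norm (f x - f y) \<le> C * d)"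
  have local: "norm (f x - f a) \<le> e * d" if "bnd f d" "ball a e \<subseteq> S" "x \<in> ball a e" for f d a e x
  proof -
    have "0 < e" using that(3) by (metis ball_eq_empty empty_iff not_le)
    have "norm (f x - f a) \<le> d * norm (x - a)"
    proof (rule differentiable_bound[where S = "ball a e" and f' = "\<lambda>z. frechet_derivative f (at z)"])
      fix z assume "z \<in> ball a e"
      then have z: "z \<in> S" using that by auto
      then show "(f has_derivative frechet_derivative f (at z)) (at z within ball a e)"
        using that(1) by (auto simp: bnd_def frechet_derivative_works intro: has_derivative_at_withinI)
      show "onorm (frechet_derivative f (at z)) \<le> d"
        using that(1) z by (auto simp: bnd_def)
    qed (use that \<open>0 < e\<close> in auto)
    moreover have "0 \<le> d"
    proof -
      have "a \<in> S" using that(2) \<open>0 < e\<close> by auto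
      then have "f differentiable at a" "onorm (frechet_derivative f (at a)) \<le> d" using that(1) by (auto simp: bnd_def)
      then show ?thesis
        by (meson frechet_derivative_works has_derivative_bounded_linear onorm_pos_le order_trans)
    qed
    moreover have "norm (x - a) \<le> e" using that(3) by (simp add: dist_norm norm_minus_commute)
    ultimately show ?thesis by (metis mult.commute mult_left_mono order_trans)
  qed
  have R: "R a b" if "a \<in> S" "b \<in> S" for a b
  proof (rule connected_equivalence_relation[OF \<open>connected S\<close> that])
    show "R y x" if "R x y" for x y
      using that by (auto simp: R_def norm_minus_commute)
    show "R x z" if "R x y" "R y z" for x y z
    proof -
      obtain C where "0 \<le> C" and C: "\<forall>f d. bnd f d \<longrightarrow> norm (f x - f y) \<le> C * d"
        using \<open>R x y\<close> unfolding R_def by (elim exE conjE)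
      obtain D where "0 \<le> D" and D: "\<forall>f d. bnd f d \<longrightarrow> norm (f y - f z) \<le> D * d"
        using \<open>R y z\<close> unfolding R_def by (elim exE conjE)
      have "norm (f x - f z) \<le> (C + D) * d" if "bnd f d" for f d
        using C[rule_format, OF that] D[rule_format, OF that] norm_triangle_ineq[of "f x - f y" "f y - f z"]
        by (simp add: algebra_simps)
      then show ?thesis unfolding R_def using \<open>0 \<le> C\<close> \<open>0 \<le> D\<close> by (intro exI[of _ "C + D"]) auto
    qed
    show "\<exists>T. openin (top_of_set S) T \<and> a \<in> T \<and> (\<forall>x\<in>T. R a x)" if "a \<in> S" for a
    proof -
      obtain e where e: "e > 0" "ball a e \<subseteq> S" using \<open>open S\<close> \<open>a \<in> S\<close> by (meson openE)
      have "R a x" if "x \<in> ball a e" for x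
        unfolding R_def using local[OF _ e(2) that] e by (intro exI[of _ e]) (auto simp: norm_minus_commute)
      then show ?thesis using e \<open>open S\<close> by (intro exI[of _ "ball a e"]) (auto simp: openin_open_eq)
    qed
  qed
  obtain x0 where x0: "x0 \<in> A" using False by auto
  have "\<exists>e C. 0 < e \<and> 0 \<le> C \<and> (\<forall>x\<in>ball a e. \<forall>f d. bnd f d \<longrightarrow> norm (f x - f x0) \<le> C * d)" if "a \<in> A" for a
  proof -
    have aS: "a \<in> S" using that assms by auto
    obtain e where e: "e > 0" "ball a e \<subseteq> S" using \<open>open S\<close> aS by (meson openE)
    obtain C where C: "C \<ge> 0" "\<forall>f d. bnd f d \<longrightarrow> norm (f a - f x0) \<le> C * d"
      using R[of a x0] aS x0 assms by (auto simp: R_def)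
    have "norm (f x - f x0) \<le> (e + C) * d" if "bnd f d" "x \<in> ball a e" for f d x
      using local[OF that(1) e(2) that(2)] C(2)[rule_format, OF that(1)]
        norm_triangle_ineq[of "f x - f a" "f a - f x0"] by (simp add: algebra_simps)
    then show ?thesis using e C by (intro exI[of _ e] exI[of _ "e + C"]) auto
  qed
  then obtain e C where eC: "\<And>a. a \<in> A \<Longrightarrow> 0 < e a \<and> 0 \<le> C a \<and>
      (\<forall>x\<in>ball a (e a). \<forall>f d. bnd f d \<longrightarrow> norm (f x - f x0) \<le> C a * d)" by metis
  have "A \<subseteq> (\<Union>a\<in>A. ball a (e a))" using eC by force
  then obtain A' where A': "A' \<subseteq> A" "finite A'" "A \<subseteq> (\<Union>a\<in>A'. ball a (e a))"
    using compactE_image[OF \<open>compact A\<close>, of A "\<lambda>a. ball a (e a)"] by auto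
  define M where "M = (\<Sum>a\<in>A'. C a)"
  have "0 \<le> M" unfolding M_def by (rule sum_nonneg) (use eC A' in auto)
  show thesis
  proof (rule that[of "2 * M"])
    show "0 \<le> 2 * M" using \<open>0 \<le> M\<close> by simp
    fix f :: "'a \<Rightarrow> 'a" and d x y
    assume "\<And>z. z \<in> S \<Longrightarrow> f differentiable at z \<and> onorm (frechet_derivative f (at z)) \<le> d"
      and xy: "x \<in> A" "y \<in> A"
    then have b: "bnd f d" by (auto simp: bnd_def)
    have *: "norm (f z - f x0) \<le> M * d" if "z \<in> A" for z
    proof -
      obtain a where a: "a \<in> A'" "z \<in> ball a (e a)" using A' \<open>z \<in> A\<close> by auto
      have "norm (f z - f x0) \<le> C a * d" using eC a A' b by auto
      moreover have "C a \<le> M" unfolding M_def by (rule member_le_sum) (use a A' eC in auto)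
      moreover have "0 \<le> d"
      proof -
        have "x0 \<in> S" using x0 assms by auto
        then have "f differentiable at x0" "onorm (frechet_derivative f (at x0)) \<le> d" using b by (auto simp: bnd_def)
        then show ?thesis
          by (meson frechet_derivative_works has_derivative_bounded_linear onorm_pos_le order_trans)
      qed
      ultimately show ?thesis by (meson mult_right_mono order_trans)
    qed
    show "norm (f x - f y) \<le> 2 * M * d"
      using *[OF xy(1)] *[OF xy(2)] norm_triangle_ineq4[of "f x - f x0" "f y - f x0"] by simp
  qed
qed

text \<open>
  Consider the largest ball around \<open>f c\<close> inside the image. The inverse is \<open>1/d\<close>-Lipschitz on this
  ball, because a ball is convex. Were its radius \<open>e\<close> less than \<open>d * r\<close>, the preimage would stay in the
  compact ball of radius \<open>e / d < r\<close>, so the image would contain the closed ball of radius \<open>e\<close> too,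
  including a nearest point of its complement.
\<close>

lemma ball_subset_image_of_expanding:
  fixes f :: "'a::euclidean_space \<Rightarrow> 'a"
  assumes der: "\<And>x. x \<in> ball c r \<Longrightarrow> (f has_derivative f' x) (at x)"
    and expand: "\<And>x v. x \<in> ball c r \<Longrightarrow> d * norm v \<le> norm (f' x v)"
    and inj: "inj_on f (ball c r)" and "0 < r" "0 < d"
  shows "ball (f c) (d * r) \<subseteq> f ` ball c r"
proof (rule ccontr)
  assume contr: "\<not> ?thesis"
  let ?U = "f ` ball c r"
  have cont: "continuous_on (ball c r) f"
    by (meson der continuous_at_imp_continuous_on has_derivative_continuous)
  have "open ?U" using invariance_of_domain[OF cont _ inj] by simp
  define g where "g = inv_into (ball c r) f"
  have gf: "g (f x) = x" if "x \<in> ball c r" for x using that inj by (simp add: g_def)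
  have ne: "- ?U \<noteq> {}" using contr by auto
  \<comment> \<open>\<open>w\<close> is a point outside the image that is nearest to \<open>f c\<close>.\<close>
  obtain w where w: "w \<in> - ?U" "infdist (f c) (- ?U) = dist (f c) w"
    using infdist_attains_inf[OF closed_Compl[OF \<open>open ?U\<close>] ne, of "f c"] by blast
  define e where "e = dist (f c) w"
  have "0 < e" unfolding e_def using w(1) \<open>0 < r\<close> by auto
  have sub: "ball (f c) e \<subseteq> ?U"
  proof (rule ccontr)
    assume "\<not> ?thesis"
    then obtain z where "z \<in> ball (f c) e" "z \<in> - ?U" by (meson ComplI subsetI)
    then show False using infdist_le[of z "- ?U" "f c"] w by (simp add: e_def)
  qed
  have "e < d * r"
  proof -
    obtain z where "z \<in> ball (f c) (d * r)" "z \<in> - ?U" using contr by (meson ComplI subsetI)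
    then show ?thesis using infdist_le[of z "- ?U" "f c"] w by (simp add: e_def)
  qed
  have gder: "\<exists>g'. (g has_derivative g') (at y) \<and> onorm g' \<le> 1 / d" if y: "y \<in> ?U" for y
  proof -
    obtain x where x: "x \<in> ball c r" "y = f x" using y by auto
    have lin: "linear (f' x)" using der[OF x(1)] has_derivative_linear by blast
    have "inj (f' x)"
    proof (rule inj_onI)
      fix u v assume "f' x u = f' x v"
      then have "f' x (u - v) = 0" using linear_diff[OF lin] by simp
      then have "d * norm (u - v) \<le> 0" using expand[OF x(1), of "u - v"] by simp
      then show "u = v" using \<open>0 < d\<close> by (simp add: mult_le_0_iff)
    qed
    then obtain g' where g': "linear g'" "g' \<circ> f' x = id" using linear_injective_left_inverse[OF lin] by blast
    then have fg: "f' x \<circ> g' = id" using linear_inverse_left[OF lin g'(1)] by blast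
    have "(g has_derivative g') (at (f x))"
      using has_derivative_inverse_strong[OF _ x(1) cont gf der[OF x(1)] fg] by simp
    moreover have "onorm g' \<le> 1 / d"
    proof (rule onorm_bound)
      fix v
      have "d * norm (g' v) \<le> norm (f' x (g' v))" by (rule expand[OF x(1)])
      also have "\<dots> = norm v" using fg by (metis comp_apply id_apply)
      finally show "norm (g' v) \<le> 1 / d * norm v" using \<open>0 < d\<close> by (simp add: field_simps)
    qed (use \<open>0 < d\<close> in simp)
    ultimately show ?thesis using x by auto
  qed
  then obtain g' where g': "\<And>y. y \<in> ?U \<Longrightarrow> (g has_derivative g' y) (at y) \<and> onorm (g' y) \<le> 1 / d" by metis
  have "ball (f c) e \<subseteq> f ` cball c (e / d)"
  proof
    fix y assume y: "y \<in> ball (f c) e"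
    have "norm (g y - g (f c)) \<le> 1 / d * norm (y - f c)"
    proof (rule differentiable_bound[where S = "ball (f c) e" and f' = g'])
      show "(g has_derivative g' z) (at z within ball (f c) e)" if "z \<in> ball (f c) e" for z
        using g' sub that by (blast intro: has_derivative_at_withinI)
      show "onorm (g' z) \<le> 1 / d" if "z \<in> ball (f c) e" for z using g' sub that by blast
    qed (use y \<open>0 < e\<close> in auto)
    also have "\<dots> \<le> 1 / d * e" using y \<open>0 < d\<close> by (intro mult_left_mono) (auto simp: dist_norm norm_minus_commute)
    finally have "g y \<in> cball c (e / d)" using gf[of c] \<open>0 < r\<close> by (simp add: dist_norm norm_minus_commute)
    moreover have "f (g y) = y" using y sub by (auto simp: g_def f_inv_into_f)
    ultimately show "y \<in> f ` cball c (e / d)" by (metis imageI)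
  qed
  moreover have cb: "cball c (e / d) \<subseteq> ball c r"
  proof -
    have "e / d < r" using \<open>e < d * r\<close> \<open>0 < d\<close> by (simp add: field_simps)
    then show ?thesis by auto
  qed
  moreover have "closed (f ` cball c (e / d))"
    by (intro compact_imp_closed compact_continuous_image continuous_on_subset[OF cont cb]) simp
  ultimately have "closure (ball (f c) e) \<subseteq> ?U" by (meson closure_minimal image_mono subset_trans)
  moreover have "w \<in> closure (ball (f c) e)" using \<open>0 < e\<close> by (simp add: e_def)
  ultimately show False using w by auto
qed

text \<open>
  Comparison of areas: all the balls lie in \<open>ball c (R + r)\<close>.
\<close>

lemma card_disjoint_balls_le:
  fixes p :: "'i \<Rightarrow> complex"
  assumes "finite A" "0 < r" "0 \<le> R"
    and disj: "\<And>i j. \<lbrakk>i \<in> A; j \<in> A; i \<noteq> j\<rbrakk> \<Longrightarrow> ball (p i) r \<inter> ball (p j) r = {}"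
    and near: "\<And>i. i \<in> A \<Longrightarrow> dist (p i) c \<le> R"
  shows "real (card A) \<le> ((R + r) / r)\<^sup>2"
proof -
  have "(\<Sum>i\<in>A. measure lebesgue (ball (p i) r)) = measure lebesgue (\<Union>i\<in>A. ball (p i) r)"
    using disj \<open>finite A\<close> by (intro measure_UNION'[symmetric]) (auto simp: pairwise_def disjnt_def)
  also have "\<dots> \<le> measure lebesgue (ball c (R + r))"
  proof (rule measure_mono_fmeasurable)
    show "(\<Union>i\<in>A. ball (p i) r) \<subseteq> ball c (R + r)"
    proof
      fix z assume "z \<in> (\<Union>i\<in>A. ball (p i) r)"
      then obtain i where "i \<in> A" "dist (p i) z < r" by auto
      then show "z \<in> ball c (R + r)" using near[of i] dist_triangle[of c z "p i"] by (simp add: dist_commute)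
    qed
  qed (use \<open>finite A\<close> in auto)
  finally have "real (card A) * (pi * r\<^sup>2) \<le> pi * (R + r)\<^sup>2"
    using \<open>0 < r\<close> \<open>0 \<le> R\<close> by (simp add: content_ball DIM_complex unit_ball_vol_2)
  then show ?thesis using \<open>0 < r\<close> by (simp add: field_simps power_divide)
qed

section \<open>Weights on trees\<close>

text \<open>
  The nodes of the tree are the finite sequences over \<open>F\<close>. If the weight of a node never exceeds the
  total weight of its children, and every infinite branch passes through \<open>\<Union>i. C i\<close>, then \<open>\<Union>i. C i\<close>
  weighs at least as much as the root. This takes the place of a measure on the branches. A
  failure of the inequality at a node \<open>u\<close>, with the elements of the \<open>C i\<close> below \<open>u\<close> on the right,
  passes on to some child; following it down gives a branch that avoids all the \<open>C i\<close>. As the \<open>C i\<close> may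
  be infinitely many, countable covers can be treated without compactness.
\<close>

lemma root_weight_le_weight_of_bar:
  fixes W :: "'b list \<Rightarrow> ennreal"
  assumes sub: "\<And>u. set u \<subseteq> F \<Longrightarrow> W u \<le> (\<Sum>v\<in>F. W (u @ [v]))"
    and "finite F" and fin: "\<And>i::nat. finite (C i)"
    and bar: "\<And>x::nat \<Rightarrow> 'b. range x \<subseteq> F \<Longrightarrow> \<exists>k i. map x [0..<k] \<in> C i"
  shows "W [] \<le> (\<Sum>i. \<Sum>c\<in>C i. W c)"
proof (rule ccontr)
  define G where "G = (\<lambda>u. \<Sum>i. \<Sum>c\<in>{c \<in> C i. prefix u c}. W c)"
  assume "\<not> ?thesis"
  then have G0: "G [] < W []" by (simp add: G_def not_le)
  have step: "\<exists>v\<in>F. G (u @ [v]) < W (u @ [v])" if "set u \<subseteq> F" "G u < W u" for u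
  proof (rule ccontr)
    assume "\<not> ?thesis"
    then have "(\<Sum>v\<in>F. W (u @ [v])) \<le> (\<Sum>v\<in>F. G (u @ [v]))" by (intro sum_mono) (auto simp: not_less)
    also have "\<dots> = (\<Sum>i. \<Sum>v\<in>F. \<Sum>c\<in>{c \<in> C i. prefix (u @ [v]) c}. W c)"
      unfolding G_def by (rule suminf_sum[symmetric]) simp
    also have "\<dots> \<le> G u" unfolding G_def
    proof (intro suminf_le allI)
      fix i
      have "(\<Sum>v\<in>F. \<Sum>c\<in>{c \<in> C i. prefix (u @ [v]) c}. W c) =
          (\<Sum>c\<in>(\<Union>v\<in>F. {c \<in> C i. prefix (u @ [v]) c}). W c)"
        using \<open>finite F\<close> fin by (intro sum.UNION_disjoint[symmetric]) (auto simp: prefix_def)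
      also have "\<dots> \<le> (\<Sum>c\<in>{c \<in> C i. prefix u c}. W c)"
        using fin by (intro sum_mono2) (auto simp: prefix_def)
      finally show "(\<Sum>v\<in>F. \<Sum>c\<in>{c \<in> C i. prefix (u @ [v]) c}. W c) \<le> (\<Sum>c\<in>{c \<in> C i. prefix u c}. W c)" .
    qed simp_all
    finally show False using sub[OF that(1)] that(2) by simp
  qed
  define pick where "pick = (\<lambda>u. SOME v. v \<in> F \<and> G (u @ [v]) < W (u @ [v]))"
  define U where "U = rec_nat [] (\<lambda>_ u. u @ [pick u])"
  define x where "x = (\<lambda>n. pick (U n))"
  have U: "set (U n) \<subseteq> F \<and> G (U n) < W (U n) \<and> x n \<in> F" for n
  proof -
    have p: "pick u \<in> F \<and> G (u @ [pick u]) < W (u @ [pick u])" if "set u \<subseteq> F" "G u < W u" for u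
      unfolding pick_def by (rule someI_ex) (use step[OF that] in blast)
    have "set (U n) \<subseteq> F \<and> G (U n) < W (U n)"
      by (induction n) (auto simp: U_def G0 p)
    then show ?thesis using p by (simp add: x_def)
  qed
  have mapU: "map x [0..<n] = U n" for n
    by (induction n) (auto simp: U_def x_def)
  obtain k i where "map x [0..<k] \<in> C i" using bar[of x] U by auto
  then have k: "U k \<in> C i" by (simp add: mapU)
  have "W (U k) \<le> (\<Sum>c\<in>{c \<in> C i. prefix (U k) c}. W c)"
    using fin k by (intro member_le_sum) auto
  also have "\<dots> \<le> G (U k)" unfolding G_def
    using sum_le_suminf[of "\<lambda>i. \<Sum>c\<in>{c \<in> C i. prefix (U k) c}. W c" "{i}"] by simp
  finally show False using U[of k] by (meson leD)
qed

section \<open>Hausdorff measure\<close>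

lemma hausdorff_measure_eq_0I:
  assumes "\<And>d e. \<lbrakk>0 < d; 0 < e\<rbrakk> \<Longrightarrow> \<exists>E :: nat \<Rightarrow> 'a::metric_space set. A \<subseteq> (\<Union>i. E i) \<and>
     (\<forall>i. bounded (E i) \<and> diameter (E i) \<le> d) \<and> (\<Sum>i. hausdorff_weight s (E i)) \<le> ennreal e"
  shows "hausdorff_measure s A = 0"
proof -
  have "hausdorff_premeasure s d A = 0" if "0 < d" for d
  proof -
    have "hausdorff_premeasure s d A \<le> ennreal e" if e: "0 < e" for e
    proof -
      obtain E :: "nat \<Rightarrow> 'a set" where E: "A \<subseteq> (\<Union>i. E i)"
          "\<forall>i. bounded (E i) \<and> diameter (E i) \<le> d" "(\<Sum>i. hausdorff_weight s (E i)) \<le> ennreal e"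
        using assms[OF \<open>0 < d\<close> e] by blast
      show ?thesis
        unfolding hausdorff_premeasure_def by (rule INF_lower2[where i = E]) (use E in simp_all)
    qed
    then have "hausdorff_premeasure s d A \<le> 0"
      by (intro ennreal_le_epsilon[of 0]) simp_all
    then show ?thesis by simp
  qed
  then show ?thesis by (simp add: hausdorff_measure_def)
qed

lemma hausdorff_measure_0_nonzero:
  assumes "A \<noteq> {}"
  shows "hausdorff_measure 0 A \<noteq> 0"
proof -
  have "1 \<le> hausdorff_premeasure 0 1 A" unfolding hausdorff_premeasure_def
  proof (rule INF_greatest, clarify)
    fix E :: "nat \<Rightarrow> 'a set" assume "A \<subseteq> (\<Union>i. E i)"
    then obtain i where "E i \<noteq> {}" using assms by blast
    then have "1 \<le> (\<Sum>i\<in>{i}. hausdorff_weight 0 (E i))" by (simp add: hausdorff_weight_def)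
    also have "\<dots> \<le> (\<Sum>i. hausdorff_weight 0 (E i))" by (rule sum_le_suminf) auto
    finally show "1 \<le> (\<Sum>i. hausdorff_weight 0 (E i))" .
  qed
  also have "\<dots> \<le> hausdorff_measure 0 A" unfolding hausdorff_measure_def by (intro SUP_upper) auto
  finally show ?thesis by auto
qed

section \<open>Conformal maps\<close>

definition conformal_at :: "(complex \<Rightarrow> complex) \<Rightarrow> complex \<Rightarrow> bool" where
  "conformal_at f x \<longleftrightarrow> f differentiable at x \<and> 0 < derivative_ratio f x \<and>
     (\<forall>v. norm (frechet_derivative f (at x) v) = derivative_ratio f x * norm v)"

lemma conformal_atI:
  assumes "(f has_derivative f') (at x)" "0 < r" "\<And>v. norm (f' v) = r * norm v"
  shows "conformal_at f x" "derivative_ratio f x = r"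
proof -
  have eq: "frechet_derivative f (at x) = f'" using frechet_derivative_at[OF assms(1)] by simp
  have "onorm f' \<le> r" by (rule onorm_bound) (use assms in auto)
  moreover have "r \<le> onorm f'"
    using onorm[OF has_derivative_bounded_linear[OF assms(1)], of 1] assms(3)[of 1] by simp
  ultimately show r: "derivative_ratio f x = r" by (simp add: derivative_ratio_def eq)
  show "conformal_at f x" using assms by (auto simp: conformal_at_def r eq differentiable_def)
qed

lemma conformal_at_id: "conformal_at id x" "derivative_ratio id x = 1"
  using conformal_atI[of id "\<lambda>v. v" x 1] has_derivative_ident[of "at x"] by (auto simp: id_def)

lemma conformal_at_compose:
  assumes "conformal_at g x" "conformal_at f (g x)"
  shows "conformal_at (f \<circ> g) x" "derivative_ratio (f \<circ> g) x = derivative_ratio f (g x) * derivative_ratio g x"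
proof -
  have "(f \<circ> g has_derivative frechet_derivative f (at (g x)) \<circ> frechet_derivative g (at x)) (at x)"
    using assms by (intro diff_chain_at) (auto simp: conformal_at_def frechet_derivative_works[symmetric])
  moreover have "0 < derivative_ratio f (g x) * derivative_ratio g x" using assms by (auto simp: conformal_at_def)
  moreover have "norm ((frechet_derivative f (at (g x)) \<circ> frechet_derivative g (at x)) v) =
      derivative_ratio f (g x) * derivative_ratio g x * norm v" for v
    using assms by (auto simp: conformal_at_def)
  ultimately show "conformal_at (f \<circ> g) x" "derivative_ratio (f \<circ> g) x = derivative_ratio f (g x) * derivative_ratio g x"
    by (auto intro: conformal_atI)
qed

text \<open>
  A Lipschitz constant bounds every difference quotient, hence the derivative.
\<close>

lemma derivative_ratio_le_lipschitz:
  assumes "conformal_at f x" "open S" "x \<in> S" and lip: "\<And>y. y \<in> S \<Longrightarrow> norm (f y - f x) \<le> L * norm (y - x)"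
  shows "derivative_ratio f x \<le> L"
proof (rule field_le_epsilon)
  fix e :: real assume "0 < e"
  let ?f' = "frechet_derivative f (at x)"
  have "(f has_derivative ?f') (at x)" using assms(1) by (simp add: conformal_at_def frechet_derivative_works[symmetric])
  then obtain d where d: "0 < d" "\<And>y. norm (y - x) < d \<Longrightarrow> norm (f y - f x - ?f' (y - x)) \<le> e * norm (y - x)"
    using \<open>0 < e\<close> unfolding has_derivative_at_alt by blast
  obtain t where t: "0 < t" "ball x t \<subseteq> S" using assms openE by blast
  define h where "h = min d t / 2"
  define y where "y = x + of_real h"
  have "0 < h" "h < d" "h < t" using d(1) t(1) by (auto simp: h_def)
  then have n: "norm (y - x) = h" by (simp add: y_def)
  then have "y \<in> S" using t(2) \<open>h < t\<close> by (auto simp: dist_norm norm_minus_commute)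
  have "derivative_ratio f x * h = norm (?f' (y - x))" using assms(1) n by (simp add: conformal_at_def)
  also have "\<dots> \<le> norm (f y - f x) + norm (f y - f x - ?f' (y - x))"
    using norm_triangle_ineq4[of "f y - f x" "f y - f x - ?f' (y - x)"] by simp
  also have "\<dots> \<le> L * h + e * h" using lip[OF \<open>y \<in> S\<close>] d(2)[of y] n \<open>h < d\<close> by simp
  finally show "derivative_ratio f x \<le> L + e" using \<open>0 < h\<close> by (simp add: distrib_right[symmetric])
qed

section \<open>Words and two-sided sequences\<close>

text \<open>
  Words are read backwards in time: the head of the list is the letter adjacent to \<open>\<omega>\<close>, so that
  \<open>prepend [a\<^sub>1, a\<^sub>2, \<dots>, a\<^sub>n] \<omega>\<close> is the sequence \<open>a\<^sub>n \<dots> a\<^sub>2 a\<^sub>1 \<omega>\<close>. With this order a longer past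
  is a longer list with the same beginning, and inclusion of cylinders is the prefix order.
\<close>

primrec prepend :: "letter list \<Rightarrow> (nat \<Rightarrow> letter) \<Rightarrow> nat \<Rightarrow> letter" where
  "prepend [] \<omega> = \<omega>"
| "prepend (a # u) \<omega> = prepend u (concat_letter a \<omega>)"

text \<open>
  The composition \<open>T (a\<^sub>1 \<omega>) \<circ> T (a\<^sub>2 a\<^sub>1 \<omega>) \<circ> \<dots> \<circ> T (a\<^sub>n \<dots> a\<^sub>1 \<omega>)\<close>, which maps the fiber over
  \<open>prepend u \<omega>\<close> into the fiber over \<open>\<omega>\<close>. Unlike \<^const>\<open>fiber_composition\<close> it depends on a finite word
  and on \<open>\<omega>\<close> separately, so that fibers can be compared.
\<close>

primrec word_map ::
    "((nat \<Rightarrow> letter) \<Rightarrow> complex \<Rightarrow> complex) \<Rightarrow> letter list \<Rightarrow> (nat \<Rightarrow> letter) \<Rightarrow> complex \<Rightarrow> complex" where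
  "word_map T [] \<omega> = id"
| "word_map T (a # u) \<omega> = T (concat_letter a \<omega>) \<circ> word_map T u (concat_letter a \<omega>)"

definition past :: "(int \<Rightarrow> letter) \<Rightarrow> nat \<Rightarrow> letter list" where
  "past \<tau> n = map (\<lambda>k. \<tau> (- 1 - int k)) [0..<n]"

definition right_shift :: "nat \<Rightarrow> (int \<Rightarrow> letter) \<Rightarrow> int \<Rightarrow> letter" where
  "right_shift k \<tau> = (\<lambda>j. \<tau> (j - int k))"

text \<open>
  The two-sided sequence with past \<open>x\<close>, listed backwards from coordinate \<open>-1\<close>, and future \<open>\<omega>\<close>.
\<close>

definition glue :: "(nat \<Rightarrow> letter) \<Rightarrow> (nat \<Rightarrow> letter) \<Rightarrow> int \<Rightarrow> letter" where
  "glue x \<omega> = (\<lambda>j. if j < 0 then x (nat (- 1 - j)) else \<omega> (nat j))"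

lemma past_Suc: "past \<tau> (Suc n) = past \<tau> n @ [\<tau> (- 1 - int n)]" and past_0: "past \<tau> 0 = []"
  by (simp_all add: past_def)

lemma length_past [simp]: "length (past \<tau> n) = n"
  by (simp add: past_def)

lemma past_in_lists: "\<tau> \<in> two_sided_shift \<Longrightarrow> past \<tau> n \<in> lists alphabet"
  by (auto simp: past_def two_sided_shift_def)

lemma glue_in_cylinder:
  assumes "\<And>k. x k \<in> alphabet" "\<omega> \<in> one_sided_shift" shows "glue x \<omega> \<in> cylinder \<omega>"
  using assms by (auto simp: cylinder_def glue_def two_sided_shift_def one_sided_shift_def tail_from_def)

lemma past_glue: "past (glue x \<omega>) n = map x [0..<n]"
  by (auto simp: past_def glue_def)

lemma prepend_append: "prepend (u @ v) \<omega> = prepend v (prepend u \<omega>)"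
  by (induction u arbitrary: \<omega>) auto

lemma concat_letter_in: "a \<in> alphabet \<Longrightarrow> \<omega> \<in> one_sided_shift \<Longrightarrow> concat_letter a \<omega> \<in> one_sided_shift"
  by (auto simp: concat_letter_def one_sided_shift_def split: nat.split)

lemma prepend_in: "u \<in> lists alphabet \<Longrightarrow> \<omega> \<in> one_sided_shift \<Longrightarrow> prepend u \<omega> \<in> one_sided_shift"
  by (induction u arbitrary: \<omega>) (auto simp: concat_letter_in)

lemma word_map_append: "word_map T (u @ v) \<omega> = word_map T u \<omega> \<circ> word_map T v (prepend u \<omega>)"
  by (induction u arbitrary: \<omega>) (auto simp: o_assoc)

lemma tail_from_Suc: "tail_from (- int (Suc n)) \<tau> = concat_letter (\<tau> (- 1 - int n)) (tail_from (- int n) \<tau>)"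
proof
  fix k show "tail_from (- int (Suc n)) \<tau> k = concat_letter (\<tau> (- 1 - int n)) (tail_from (- int n) \<tau>) k"
    by (cases k) (auto simp: tail_from_def concat_letter_def algebra_simps)
qed

lemma tail_from_past: "tail_from (- int n) \<tau> = prepend (past \<tau> n) (tail_from 0 \<tau>)"
proof (induction n)
  case 0 then show ?case by (simp add: past_0)
next
  case (Suc n)
  then show ?case by (simp only: tail_from_Suc past_Suc prepend_append prepend.simps)
qed

lemma fiber_composition_eq_word_map:
  "fiber_composition T \<tau> n = word_map T (past \<tau> n) (tail_from 0 \<tau>)"
proof (induction n)
  case 0 then show ?case by (simp add: past_0)
next
  case (Suc n)
  show ?case
    by (simp only: fiber_composition.simps Suc past_Suc word_map_append word_map.simps comp_id
        tail_from_past prepend_append prepend.simps)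
qed

lemma right_shift_in: "\<tau> \<in> two_sided_shift \<Longrightarrow> right_shift k \<tau> \<in> two_sided_shift"
  by (auto simp: right_shift_def two_sided_shift_def)

lemma right_shift_Suc: "right_shift (Suc k) \<tau> = right_shift 1 (right_shift k \<tau>)"
  by (auto simp: right_shift_def algebra_simps)

lemma right_shift_0 [simp]: "right_shift 0 \<tau> = \<tau>"
  by (simp add: right_shift_def)

lemma tail_from_right_shift: "tail_from m (right_shift k \<tau>) = tail_from (m - int k) \<tau>"
  by (auto simp: right_shift_def tail_from_def algebra_simps)

lemma tail_from_in: "\<tau> \<in> two_sided_shift \<Longrightarrow> tail_from m \<tau> \<in> one_sided_shift"
  by (auto simp: two_sided_shift_def one_sided_shift_def tail_from_def)

lemma fiber_composition_Suc_left:
  "fiber_composition T \<tau> (Suc n) = T (tail_from (- 1) \<tau>) \<circ> fiber_composition T (right_shift 1 \<tau>) n"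
proof (induction n)
  case (Suc n)
  have "tail_from (- int (Suc (Suc n))) \<tau> = tail_from (- int (Suc n)) (right_shift 1 \<tau>)"
    by (simp add: tail_from_right_shift)
  then show ?case
    by (simp only: fiber_composition.simps(2)[of T \<tau> "Suc n"] Suc o_assoc
        fiber_composition.simps(2)[of T "right_shift 1 \<tau>" n])
qed simp

context conformal_Smale_skew_product
begin

section \<open>Fiber maps along words and the coding\<close>

lemma compact_Y: "compact Y" and Y_nonempty: "Y \<noteq> {}"
proof -
  show "compact Y" using Y_closure by auto
  show "Y \<noteq> {}" using Y_interior by auto
qed

lemma T_Ys: "\<omega> \<in> one_sided_shift \<Longrightarrow> T \<omega> ` Ys \<subseteq> Ys"
  using T_conformal unfolding C1_conformal_embedding_def by blast

lemma T_homeo: assumes "\<omega> \<in> one_sided_shift" shows "inj_on (T \<omega>) Ys" "continuous_on Ys (T \<omega>)"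
proof -
  obtain g where "homeomorphism Ys (T \<omega> ` Ys) (T \<omega>) g"
    using T_conformal[OF assms] unfolding C1_conformal_embedding_def by blast
  then show "inj_on (T \<omega>) Ys" "continuous_on Ys (T \<omega>)"
    by (auto simp: homeomorphism_def intro: inj_on_inverseI)
qed

lemma T_conformal_at: "\<omega> \<in> one_sided_shift \<Longrightarrow> y \<in> Ys \<Longrightarrow> conformal_at (T \<omega>) y"
  using T_conformal unfolding C1_conformal_embedding_def by (meson conformal_atI(1))

lemma T_interior: assumes "\<omega> \<in> one_sided_shift" shows "T \<omega> ` interior Y \<subseteq> interior Y"
proof (rule interior_maximal)
  show "T \<omega> ` interior Y \<subseteq> Y" using T_maps[OF assms] interior_subset by blast
  have "interior Y \<subseteq> Ys" using Ys_domain interior_subset by blast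
  then show "open (T \<omega> ` interior Y)"
    using T_homeo[OF assms] by (intro invariance_of_domain) (auto intro: continuous_on_subset inj_on_subset)
qed

lemma word_map_invariant:
  assumes "u \<in> lists alphabet" "\<omega> \<in> one_sided_shift"
  shows "word_map T u \<omega> ` Ys \<subseteq> Ys" "word_map T u \<omega> ` Y \<subseteq> Y"
    "word_map T u \<omega> ` interior Y \<subseteq> interior Y" "inj_on (word_map T u \<omega>) Ys"
    "continuous_on Ys (word_map T u \<omega>)"
    "\<And>y. y \<in> Ys \<Longrightarrow> conformal_at (word_map T u \<omega>) y"
proof -
  have "word_map T u \<omega> ` Ys \<subseteq> Ys \<and> word_map T u \<omega> ` Y \<subseteq> Y \<and>
    word_map T u \<omega> ` interior Y \<subseteq> interior Y \<and> inj_on (word_map T u \<omega>) Ys \<and>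
    continuous_on Ys (word_map T u \<omega>) \<and> (\<forall>y\<in>Ys. conformal_at (word_map T u \<omega>) y)"
    using assms
  proof (induction u arbitrary: \<omega> rule: list.induct)
    case Nil
    then show ?case by (auto simp: conformal_at_id id_def[symmetric])
  next
    case (Cons a u)
    define \<omega>' where "\<omega>' = concat_letter a \<omega>"
    have \<omega>': "\<omega>' \<in> one_sided_shift" using Cons.prems by (simp add: \<omega>'_def concat_letter_in)
    let ?f = "word_map T u \<omega>'"
    have IH: "?f ` Ys \<subseteq> Ys" "?f ` Y \<subseteq> Y" "?f ` interior Y \<subseteq> interior Y" "inj_on ?f Ys"
      "continuous_on Ys ?f" "\<forall>y\<in>Ys. conformal_at ?f y"
      using Cons.IH[of \<omega>'] Cons.prems \<omega>' by auto
    have "inj_on (T \<omega>' \<circ> ?f) Ys"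
      using IH T_homeo(1)[OF \<omega>'] by (intro comp_inj_on) (auto intro: inj_on_subset)
    moreover have "continuous_on Ys (T \<omega>' \<circ> ?f)"
      using IH T_homeo(2)[OF \<omega>'] by (intro continuous_on_compose) (auto intro: continuous_on_subset)
    moreover have "\<forall>y\<in>Ys. conformal_at (T \<omega>' \<circ> ?f) y"
      using IH T_conformal_at[OF \<omega>'] by (auto intro!: conformal_at_compose)
    moreover have "(T \<omega>' \<circ> ?f) ` Ys \<subseteq> Ys" using IH(1) T_Ys[OF \<omega>'] by force
    moreover have "(T \<omega>' \<circ> ?f) ` Y \<subseteq> Y" using IH(2) T_maps[OF \<omega>'] by force
    moreover have "(T \<omega>' \<circ> ?f) ` interior Y \<subseteq> interior Y" using IH(3) T_interior[OF \<omega>'] by force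
    ultimately show ?case by (simp only: word_map.simps \<omega>'_def[symmetric])
  qed
  then show "word_map T u \<omega> ` Ys \<subseteq> Ys" "word_map T u \<omega> ` Y \<subseteq> Y"
    "word_map T u \<omega> ` interior Y \<subseteq> interior Y" "inj_on (word_map T u \<omega>) Ys"
    "continuous_on Ys (word_map T u \<omega>)"
    "\<And>y. y \<in> Ys \<Longrightarrow> conformal_at (word_map T u \<omega>) y"
    by blast+
qed

text \<open>
  The bound on the derivative is the Lipschitz bound at infinitesimal scale.
\<close>

lemma word_map_contraction:
  obtains q where "0 < q" "q < 1"
    "\<And>u \<omega> y z. \<lbrakk>u \<in> lists alphabet; \<omega> \<in> one_sided_shift; y \<in> Ys; z \<in> Ys\<rbrakk> \<Longrightarrow>
       norm (word_map T u \<omega> y - word_map T u \<omega> z) \<le> q ^ length u * norm (y - z)"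
    "\<And>u \<omega> y. \<lbrakk>u \<in> lists alphabet; \<omega> \<in> one_sided_shift; y \<in> Ys\<rbrakk> \<Longrightarrow>
       derivative_ratio (word_map T u \<omega>) y \<le> q ^ length u"
proof -
  obtain l where l: "l > 1" "\<And>\<omega> y z. \<lbrakk>\<omega> \<in> one_sided_shift; y \<in> Ys; z \<in> Ys\<rbrakk> \<Longrightarrow>
      norm (T \<omega> y - T \<omega> z) \<le> inverse l * norm (y - z)" using T_contraction by blast
  define q where "q = inverse l"
  have q: "0 < q" "q < 1" using l(1) by (auto simp: q_def field_simps)
  have lip: "norm (word_map T u \<omega> y - word_map T u \<omega> z) \<le> q ^ length u * norm (y - z)"
    if "u \<in> lists alphabet" "\<omega> \<in> one_sided_shift" "y \<in> Ys" "z \<in> Ys" for u \<omega> y z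
    using that
  proof (induction u arbitrary: \<omega> rule: list.induct)
    case (Cons a u)
    define \<omega>' where "\<omega>' = concat_letter a \<omega>"
    have \<omega>': "\<omega>' \<in> one_sided_shift" and u: "u \<in> lists alphabet" using Cons.prems by (auto simp: \<omega>'_def concat_letter_in)
    have "norm (T \<omega>' (word_map T u \<omega>' y) - T \<omega>' (word_map T u \<omega>' z)) \<le>
        q * norm (word_map T u \<omega>' y - word_map T u \<omega>' z)"
      unfolding q_def using word_map_invariant(1)[OF u \<omega>'] Cons.prems by (intro l(2)[OF \<omega>']) auto
    also have "\<dots> \<le> q * (q ^ length u * norm (y - z))"
      using Cons.IH[OF u \<omega>' Cons.prems(3,4)] q by (intro mult_left_mono) auto
    finally show ?case by (simp add: \<omega>'_def mult.assoc)
  qed simp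
  have "derivative_ratio (word_map T u \<omega>) y \<le> q ^ length u"
    if "u \<in> lists alphabet" "\<omega> \<in> one_sided_shift" "y \<in> Ys" for u \<omega> y
    using word_map_invariant(6)[OF that] Ys_domain(1) that(3)
    by (rule derivative_ratio_le_lipschitz) (use lip that in auto)
  then show thesis using q lip that by blast
qed

text \<open>
  The images of \<open>Y\<close> are compact and decreasing, so they have a common point; they shrink
  geometrically, so it is unique. This makes the definite description in \<^const>\<open>fiber_coding\<close>
  meaningful and removes the closures.
\<close>

lemma fiber_coding_unique:
  assumes "\<tau> \<in> two_sided_shift"
  shows "fiber_coding T Y \<tau> \<in> fiber_composition T \<tau> n ` Y"
    and "(\<And>n. x \<in> fiber_composition T \<tau> n ` Y) \<Longrightarrow> x = fiber_coding T Y \<tau>"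
proof -
  define A where "A = (\<lambda>n. fiber_composition T \<tau> n ` Y)"
  obtain q where q: "0 < q" "q < 1"
    "\<And>u \<omega> y z. \<lbrakk>u \<in> lists alphabet; \<omega> \<in> one_sided_shift; y \<in> Ys; z \<in> Ys\<rbrakk> \<Longrightarrow>
       norm (word_map T u \<omega> y - word_map T u \<omega> z) \<le> q ^ length u * norm (y - z)"
    by (rule word_map_contraction) blast
  note tl = tail_from_in[OF assms]
  have comp: "compact (A n)" for n
    unfolding A_def fiber_composition_eq_word_map
    by (intro compact_continuous_image compact_Y continuous_on_subset[OF word_map_invariant(5)]
        past_in_lists assms tl Ys_domain)
  have dec: "A (Suc n) \<subseteq> A n" for n
    unfolding A_def using T_maps[OF tl] by (auto simp: image_comp[symmetric] image_subset_iff simp del: of_nat_Suc)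
  have anti: "A n \<subseteq> A m" if "m \<le> n" for m n using dec that by (rule lift_Suc_antimono_le)
  have "(\<Inter>n. A n) \<noteq> {}"
    by (rule compact_nest) (use comp anti Y_nonempty in \<open>auto simp: A_def\<close>)
  then obtain x0 where x0: "\<And>n. x0 \<in> A n" by auto
  have uniq: "x = y" if xy: "\<And>n. x \<in> A n" "\<And>n. y \<in> A n" for x y
  proof -
    obtain B where B: "\<And>a b. a \<in> Y \<Longrightarrow> b \<in> Y \<Longrightarrow> norm (a - b) \<le> B"
      using compact_imp_bounded[OF compact_Y] unfolding bounded_two_points dist_norm by blast
    have "norm (x - y) \<le> q ^ n * B" for n
    proof -
      obtain a b where ab: "a \<in> Y" "b \<in> Y" "x = fiber_composition T \<tau> n a" "y = fiber_composition T \<tau> n b"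
        using xy(1)[of n] xy(2)[of n] by (auto simp: A_def)
      have "norm (x - y) \<le> q ^ n * norm (a - b)"
        using q(3)[OF past_in_lists[OF assms] tl, of a b n] ab Ys_domain by (auto simp: fiber_composition_eq_word_map)
      also have "\<dots> \<le> q ^ n * B" using B ab q by (intro mult_left_mono) auto
      finally show ?thesis .
    qed
    moreover have "(\<lambda>n. q ^ n * B) \<longlonglongrightarrow> 0 * B" using q by (intro tendsto_intros LIMSEQ_power_zero) auto
    ultimately have "norm (x - y) \<le> 0" using LIMSEQ_le_const[of "\<lambda>n. q ^ n * B" 0 "norm (x - y)"] by auto
    then show ?thesis by simp
  qed
  have iff: "x \<in> (\<Inter>n\<in>{1..}. closure (fiber_composition T \<tau> n ` Y)) \<longleftrightarrow> (\<forall>n. x \<in> A n)" for x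
  proof -
    have "closure (fiber_composition T \<tau> n ` Y) = A n" for n
      using comp[of n] by (simp add: A_def compact_imp_closed)
    moreover have "x \<in> A n" if "\<forall>n\<in>{1..}. x \<in> A n" for n
      using that anti[of 0 1] by (cases n) auto
    ultimately show ?thesis by auto
  qed
  have "fiber_coding T Y \<tau> = x0"
    unfolding fiber_coding_def iff by (rule the_equality) (use x0 uniq in auto)
  then show "fiber_coding T Y \<tau> \<in> fiber_composition T \<tau> n ` Y"
    and "(\<And>n. x \<in> fiber_composition T \<tau> n ` Y) \<Longrightarrow> x = fiber_coding T Y \<tau>"
    using x0 uniq[of x x0] by (auto simp: A_def)
qed

lemma fiber_coding_in_Y: "\<tau> \<in> two_sided_shift \<Longrightarrow> fiber_coding T Y \<tau> \<in> Y"
  using fiber_coding_unique(1)[of \<tau> 0] by simp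

lemma fiber_coding_shift:
  assumes "\<tau> \<in> two_sided_shift"
  shows "T (tail_from (- 1) \<tau>) (fiber_coding T Y (right_shift 1 \<tau>)) = fiber_coding T Y \<tau>"
proof (rule fiber_coding_unique(2)[OF assms])
  fix n
  let ?x = "T (tail_from (- 1) \<tau>) (fiber_coding T Y (right_shift 1 \<tau>))"
  note sh = right_shift_in[OF assms]
  show "?x \<in> fiber_composition T \<tau> n ` Y"
  proof (cases n)
    case 0
    then show ?thesis using T_maps[OF tail_from_in[OF assms]] fiber_coding_in_Y[OF sh] by auto
  next
    case (Suc m)
    then show ?thesis
      using fiber_coding_unique(1)[OF sh, of 1 m] by (auto simp only: fiber_composition_Suc_left image_comp[symmetric])
  qed
qed

text \<open>
  By the chain rule the logarithmic derivative along a past of length \<open>n\<close>, evaluated at the coding of the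
  shifted sequence, is a Birkhoff sum of the potential from \<open>T_potential\<close>.
\<close>

lemma ln_ratio_along_orbit:
  assumes "\<tau> \<in> two_sided_shift"
  shows "ln (derivative_ratio (fiber_composition T \<tau> n) (fiber_coding T Y (right_shift n \<tau>))) =
    (\<Sum>k<n. ln (derivative_ratio (T (tail_from 0 (right_shift (Suc k) \<tau>))) (fiber_coding T Y (right_shift (Suc k) \<tau>))))"
proof (induction n)
  case 0
  then show ?case using conformal_at_id(2)[of "fiber_coding T Y \<tau>"] by (simp add: id_def)
next
  case (Suc n)
  define \<tau>' where "\<tau>' = right_shift n \<tau>"
  define z where "z = fiber_coding T Y (right_shift (Suc n) \<tau>)"
  have z: "z \<in> Ys" using fiber_coding_in_Y[OF right_shift_in[OF assms]] Ys_domain by (auto simp: z_def)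
  have tl: "tail_from (- int (Suc n)) \<tau> = tail_from (- 1) \<tau>'" by (simp add: \<tau>'_def tail_from_right_shift)
  have tl0: "tail_from (- 1) \<tau>' = tail_from 0 (right_shift (Suc n) \<tau>)"
    by (simp add: \<tau>'_def tail_from_right_shift)
  have Tz: "T (tail_from (- 1) \<tau>') z = fiber_coding T Y \<tau>'"
    unfolding z_def right_shift_Suc \<tau>'_def[symmetric] by (rule fiber_coding_shift) (simp add: \<tau>'_def assms right_shift_in)
  have "fiber_coding T Y \<tau>' \<in> Ys" using fiber_coding_in_Y[OF right_shift_in[OF assms]] Ys_domain by (auto simp: \<tau>'_def)
  then have c1: "conformal_at (fiber_composition T \<tau> n) (T (tail_from (- 1) \<tau>') z)"
    unfolding Tz fiber_composition_eq_word_map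
    by (intro word_map_invariant(6) past_in_lists tail_from_in assms)
  have c2: "conformal_at (T (tail_from (- 1) \<tau>')) z"
    using z by (intro T_conformal_at tail_from_in) (simp add: \<tau>'_def assms right_shift_in)
  have f1: "derivative_ratio (fiber_composition T \<tau> (Suc n)) z =
      derivative_ratio (fiber_composition T \<tau> n) (fiber_coding T Y \<tau>') * derivative_ratio (T (tail_from (- 1) \<tau>')) z"
    using conformal_at_compose(2)[OF c2 c1] by (simp add: tl[simplified] Tz)
  have f2: "ln (derivative_ratio (fiber_composition T \<tau> n) (fiber_coding T Y \<tau>') * derivative_ratio (T (tail_from (- 1) \<tau>')) z) =
      ln (derivative_ratio (fiber_composition T \<tau> n) (fiber_coding T Y \<tau>')) +
      ln (derivative_ratio (T (tail_from (- 1) \<tau>')) z)"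
    using c1 c2 by (intro ln_mult_pos) (auto simp: conformal_at_def Tz)
  show ?case
    unfolding sum.lessThan_Suc z_def[symmetric] f1 f2 tl0[symmetric] using Suc by (simp add: \<tau>'_def)
qed

section \<open>Bounded distortion\<close>

text \<open>
  After \<open>k\<close> contractions the images of two points are within \<open>q^k * B\<close>, where \<open>B\<close> bounds the diameter of
  \<open>Ys\<close>; summing \<open>T_distortion\<close> over the orbit gives a geometric series of ratio \<open>q powr \<alpha>\<close>.
\<close>

lemma fixed_fiber_distortion:
  obtains K where "0 \<le> K"
    "\<And>u \<omega> y z. \<lbrakk>u \<in> lists alphabet; \<omega> \<in> one_sided_shift; y \<in> Ys; z \<in> Ys\<rbrakk> \<Longrightarrow>
      \<bar>ln (derivative_ratio (word_map T u \<omega>) y) - ln (derivative_ratio (word_map T u \<omega>) z)\<bar> \<le> K"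
proof -
  obtain \<alpha> H where H: "0 < \<alpha>" "0 < H" "\<And>\<omega> y z. \<lbrakk>\<omega> \<in> one_sided_shift; y \<in> Ys; z \<in> Ys\<rbrakk> \<Longrightarrow>
      \<bar>ln (derivative_ratio (T \<omega>) y) - ln (derivative_ratio (T \<omega>) z)\<bar> \<le> H * norm (y - z) powr \<alpha>"
    using T_distortion by blast
  obtain q where q: "0 < q" "q < 1"
    "\<And>u \<omega> y z. \<lbrakk>u \<in> lists alphabet; \<omega> \<in> one_sided_shift; y \<in> Ys; z \<in> Ys\<rbrakk> \<Longrightarrow>
       norm (word_map T u \<omega> y - word_map T u \<omega> z) \<le> q ^ length u * norm (y - z)"
    by (rule word_map_contraction) blast
  obtain B where B: "\<And>a b. a \<in> Ys \<Longrightarrow> b \<in> Ys \<Longrightarrow> norm (a - b) \<le> B"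
    using Ys_domain(3) unfolding bounded_two_points dist_norm by blast
  define p where "p = q powr \<alpha>"
  have p: "0 < p" "p < 1" using q H powr_less_mono2[of \<alpha> q 1] by (auto simp: p_def)
  have *: "\<bar>ln (derivative_ratio (word_map T u \<omega>) y) - ln (derivative_ratio (word_map T u \<omega>) z)\<bar>
      \<le> (\<Sum>k<length u. H * B powr \<alpha> * p ^ k)"
    if "u \<in> lists alphabet" "\<omega> \<in> one_sided_shift" "y \<in> Ys" "z \<in> Ys" for u \<omega> y z
    using that
  proof (induction u arbitrary: \<omega> rule: list.induct)
    case Nil
    then show ?case using conformal_at_id(2) by (simp add: id_def)
  next
    case (Cons a u)
    define \<omega>' where "\<omega>' = concat_letter a \<omega>"
    let ?f = "word_map T u \<omega>'"
    have \<omega>': "\<omega>' \<in> one_sided_shift" and u: "u \<in> lists alphabet" using Cons.prems by (auto simp: \<omega>'_def concat_letter_in)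
    have ln: "ln (derivative_ratio (word_map T (a # u) \<omega>) x) = ln (derivative_ratio (T \<omega>') (?f x)) + ln (derivative_ratio ?f x)"
      and fx: "?f x \<in> Ys" if "x \<in> Ys" for x
    proof -
      show "?f x \<in> Ys" using word_map_invariant(1)[OF u \<omega>'] that by auto
      then have c: "conformal_at (T \<omega>') (?f x)" "conformal_at ?f x"
        using T_conformal_at[OF \<omega>'] word_map_invariant(6)[OF u \<omega>' that] by auto
      then show "ln (derivative_ratio (word_map T (a # u) \<omega>) x) = ln (derivative_ratio (T \<omega>') (?f x)) + ln (derivative_ratio ?f x)"
        unfolding word_map.simps \<omega>'_def[symmetric] conformal_at_compose(2)[OF c(2,1)]
        by (intro ln_mult_pos) (auto simp: conformal_at_def)
    qed
    have "norm (?f y - ?f z) \<le> q ^ length u * B"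
      using q(3)[OF u \<omega>' Cons.prems(3,4)] B[OF Cons.prems(3,4)] q(1)
      by (meson mult_left_mono order_trans zero_le_power less_imp_le)
    then have "norm (?f y - ?f z) powr \<alpha> \<le> (q ^ length u * B) powr \<alpha>" using H(1) by (intro powr_mono2) auto
    also have "\<dots> = B powr \<alpha> * p ^ length u"
      using q(1) B[OF Cons.prems(3) Cons.prems(3)] by (simp add: p_def powr_mult powr_realpow[symmetric] powr_powr mult.commute)
    finally have "H * norm (?f y - ?f z) powr \<alpha> \<le> H * B powr \<alpha> * p ^ length u" using H(2) by simp
    then have "\<bar>ln (derivative_ratio (T \<omega>') (?f y)) - ln (derivative_ratio (T \<omega>') (?f z))\<bar> \<le> H * B powr \<alpha> * p ^ length u"
      using H(3)[OF \<omega>' fx fx, OF Cons.prems(3,4)] by linarith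
    moreover have "(\<Sum>k<length (a # u). H * B powr \<alpha> * p ^ k) = (\<Sum>k<length u. H * B powr \<alpha> * p ^ k) + H * B powr \<alpha> * p ^ length u"
      by simp
    ultimately show ?case
      unfolding ln[OF Cons.prems(3)] ln[OF Cons.prems(4)] using Cons.IH[OF u \<omega>' Cons.prems(3,4)] by linarith
  qed
  have bound: "(\<Sum>k<n. H * B powr \<alpha> * p ^ k) \<le> H * B powr \<alpha> * (1 / (1 - p))" for n
  proof -
    have "(\<Sum>k<n. p ^ k) \<le> (\<Sum>k. p ^ k)" using p by (intro sum_le_suminf) auto
    then have "(\<Sum>k<n. p ^ k) \<le> 1 / (1 - p)" using p by (simp add: suminf_geometric)
    from mult_left_mono[OF this, of "H * B powr \<alpha>"] show ?thesis using H by (simp add: sum_distrib_left)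
  qed
  show thesis
    by (rule that[OF _ order_trans[OF * bound]]) (use p H in auto)
qed

text \<open>
  The comparison is made at the points \<open>y\<close>, \<open>z\<close> coded by one common past that begins with \<open>u\<close>, continued
  by \<open>\<omega>\<close> and by \<open>\<omega>'\<close>. Shifted right by \<open>Suc k\<close> places, these two sequences agree on \<open>\<bar>j\<bar> \<le> k\<close>, so the terms
  of their Birkhoff sums differ by at most \<open>C * exp (- \<beta> * k)\<close>.
\<close>

lemma cross_fiber_distortion:
  obtains K where "0 \<le> K"
    "\<And>u \<omega> \<omega>'. \<lbrakk>u \<in> lists alphabet; \<omega> \<in> one_sided_shift; \<omega>' \<in> one_sided_shift\<rbrakk> \<Longrightarrow>
      \<exists>y\<in>Ys. \<exists>z\<in>Ys. \<bar>ln (derivative_ratio (word_map T u \<omega>) y) - ln (derivative_ratio (word_map T u \<omega>') z)\<bar> \<le> K"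
proof -
  define \<psi> where "\<psi> = (\<lambda>\<tau>. ln (derivative_ratio (T (tail_from 0 \<tau>)) (fiber_coding T Y \<tau>)))"
  obtain C \<beta> where C: "0 < C" "0 < \<beta>" "\<And>\<eta> \<xi> n. \<lbrakk>\<eta> \<in> two_sided_shift; \<xi> \<in> two_sided_shift;
      \<And>k. \<bar>k\<bar> \<le> int n \<Longrightarrow> \<eta> k = \<xi> k\<rbrakk> \<Longrightarrow> \<bar>\<psi> \<eta> - \<psi> \<xi>\<bar> \<le> C * exp (- \<beta> * real n)"
    using T_potential unfolding holder_two_sided_def \<psi>_def by blast
  define p where "p = exp (- \<beta>)"
  have p: "0 < p" "p < 1" using C by (auto simp: p_def)
  have "\<exists>y\<in>Ys. \<exists>z\<in>Ys. \<bar>ln (derivative_ratio (word_map T u \<omega>) y) - ln (derivative_ratio (word_map T u \<omega>') z)\<bar> \<le> C * (1 / (1 - p))"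
    if u: "u \<in> lists alphabet" and \<omega>: "\<omega> \<in> one_sided_shift" "\<omega>' \<in> one_sided_shift" for u \<omega> \<omega>'
  proof -
    define n where "n = length u"
    define x where "x = (\<lambda>k. if k < n then u ! k else (1, 1))"
    have "x k \<in> alphabet" for k using u nth_mem[of k u] by (auto simp: x_def n_def alphabet_def)
    then have gl: "glue x \<omega> \<in> cylinder \<omega>" "glue x \<omega>' \<in> cylinder \<omega>'" using \<omega> by (auto intro: glue_in_cylinder)
    then have two: "glue x \<omega> \<in> two_sided_shift" "glue x \<omega>' \<in> two_sided_shift" by (auto simp: cylinder_def)
    have "map x [0..<n] = u" unfolding x_def n_def by (rule nth_equalityI) auto
    then have wm: "fiber_composition T (glue x \<omega>) n = word_map T u \<omega>" "fiber_composition T (glue x \<omega>') n = word_map T u \<omega>'"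
      using gl by (auto simp: fiber_composition_eq_word_map past_glue cylinder_def)
    define y where "y = fiber_coding T Y (right_shift n (glue x \<omega>))"
    define z where "z = fiber_coding T Y (right_shift n (glue x \<omega>'))"
    have yz: "y \<in> Ys" "z \<in> Ys" unfolding y_def z_def using Ys_domain(4) fiber_coding_in_Y right_shift_in two by blast+
    have "ln (derivative_ratio (word_map T u \<omega>) y) - ln (derivative_ratio (word_map T u \<omega>') z) =
       (\<Sum>k<n. \<psi> (right_shift (Suc k) (glue x \<omega>)) - \<psi> (right_shift (Suc k) (glue x \<omega>')))"
      using ln_ratio_along_orbit[OF two(1), of n] ln_ratio_along_orbit[OF two(2), of n]
      unfolding wm y_def[symmetric] z_def[symmetric] \<psi>_def by (simp add: sum_subtractf)
    also have "\<bar>\<dots>\<bar> \<le> (\<Sum>k<n. C * p ^ k)"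
    proof (rule order_trans[OF sum_abs], rule sum_mono)
      fix k
      have "\<bar>\<psi> (right_shift (Suc k) (glue x \<omega>)) - \<psi> (right_shift (Suc k) (glue x \<omega>'))\<bar> \<le> C * exp (- \<beta> * real k)"
        by (intro C(3) right_shift_in two) (auto simp: right_shift_def glue_def)
      also have "exp (- \<beta> * real k) = p ^ k" by (simp add: p_def exp_of_nat_mult[symmetric] mult.commute)
      finally show "\<bar>\<psi> (right_shift (Suc k) (glue x \<omega>)) - \<psi> (right_shift (Suc k) (glue x \<omega>'))\<bar> \<le> C * p ^ k" .
    qed
    also have "\<dots> \<le> C * (1 / (1 - p))"
    proof -
      have "(\<Sum>k<n. p ^ k) \<le> (\<Sum>k. p ^ k)" using p by (intro sum_le_suminf) auto
    then have "(\<Sum>k<n. p ^ k) \<le> 1 / (1 - p)" using p by (simp add: suminf_geometric)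
    from mult_left_mono[OF this, of "C"] show ?thesis using C by (simp add: sum_distrib_left)
    qed
    finally show ?thesis using yz by blast
  qed
  then show thesis using p C by (intro that[of "C * (1 / (1 - p))"]) auto
qed

text \<open>
  The derivative ratio of \<open>word_map T u\<close> in an arbitrary reference fiber and at an arbitrary reference
  point. By bounded distortion it is comparable to the ratio in every fiber and at every point, with
  a factor independent of \<open>u\<close>; for this reason it is also multiplicative up to a bounded
  factor. One constant serves for both in the predicate \<open>distortion_constant\<close>.
\<close>

definition word_scale :: "letter list \<Rightarrow> real" where
  "word_scale u = derivative_ratio (word_map T u (\<lambda>_. (1, 1))) (SOME y. y \<in> Y)"

lemma base_point_valid:
  shows "(SOME y. y \<in> Y) \<in> Y" "(\<lambda>_. (1, 1)) \<in> one_sided_shift"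
  using Y_nonempty by (auto simp: some_in_eq one_sided_shift_def alphabet_def)

lemma word_scale_Nil: "word_scale [] = 1"
  by (simp add: word_scale_def conformal_at_id(2)[unfolded id_def] id_def)

lemma word_scale_pos: "u \<in> lists alphabet \<Longrightarrow> 0 < word_scale u"
  using word_map_invariant(6)[OF _ base_point_valid(2)] base_point_valid(1) Ys_domain(4)
  by (auto simp: word_scale_def conformal_at_def)

definition distortion_constant :: "real \<Rightarrow> bool" where
  "distortion_constant K \<longleftrightarrow> 1 \<le> K \<and>
    (\<forall>u\<in>lists alphabet. \<forall>\<omega>\<in>one_sided_shift. \<forall>y\<in>Ys.
       derivative_ratio (word_map T u \<omega>) y \<le> K * word_scale u \<and>
       word_scale u \<le> K * derivative_ratio (word_map T u \<omega>) y) \<and>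
    (\<forall>u\<in>lists alphabet. \<forall>v\<in>lists alphabet.
       word_scale (u @ v) \<le> K * (word_scale u * word_scale v) \<and>
       word_scale u * word_scale v \<le> K * word_scale (u @ v))"

lemma distortion_constant_exists: obtains K where "distortion_constant K"
proof -
  obtain A where A: "0 \<le> A" "\<And>u \<omega> y z. \<lbrakk>u \<in> lists alphabet; \<omega> \<in> one_sided_shift; y \<in> Ys; z \<in> Ys\<rbrakk> \<Longrightarrow>
      \<bar>ln (derivative_ratio (word_map T u \<omega>) y) - ln (derivative_ratio (word_map T u \<omega>) z)\<bar> \<le> A"
    by (rule fixed_fiber_distortion) blast
  obtain B where B: "0 \<le> B" "\<And>u \<omega> \<omega>'. \<lbrakk>u \<in> lists alphabet; \<omega> \<in> one_sided_shift; \<omega>' \<in> one_sided_shift\<rbrakk> \<Longrightarrow>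
      \<exists>y\<in>Ys. \<exists>z\<in>Ys. \<bar>ln (derivative_ratio (word_map T u \<omega>) y) - ln (derivative_ratio (word_map T u \<omega>') z)\<bar> \<le> B"
    by (rule cross_fiber_distortion) blast
  define L where "L = exp (2 * A + B)"
  have L: "1 \<le> L" using A B by (simp add: L_def)
  have cmp: "derivative_ratio (word_map T u \<omega>) y \<le> L * derivative_ratio (word_map T u \<omega>') z"
    if u: "u \<in> lists alphabet" and \<omega>: "\<omega> \<in> one_sided_shift" "\<omega>' \<in> one_sided_shift" and yz: "y \<in> Ys" "z \<in> Ys" for u \<omega> \<omega>' y z
  proof -
    obtain y' z' where y': "y' \<in> Ys" "z' \<in> Ys"
      "\<bar>ln (derivative_ratio (word_map T u \<omega>) y') - ln (derivative_ratio (word_map T u \<omega>') z')\<bar> \<le> B"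
      using B(2)[OF u \<omega>] by blast
    have "ln (derivative_ratio (word_map T u \<omega>) y) \<le> (2 * A + B) + ln (derivative_ratio (word_map T u \<omega>') z)"
      using y'(3) A(2)[OF u \<omega>(1) yz(1) y'(1)] A(2)[OF u \<omega>(2) yz(2) y'(2)] by linarith
    moreover have "0 < derivative_ratio (word_map T u \<omega>) y" "0 < derivative_ratio (word_map T u \<omega>') z"
      using word_map_invariant(6)[OF u] \<omega> yz by (auto simp: conformal_at_def)
    ultimately show ?thesis by (metis L_def exp_add exp_le_cancel_iff exp_ln)
  qed
  note base = base_point_valid(2) subsetD[OF Ys_domain(4) base_point_valid(1)]
  have L2: "L \<le> L * L" using L by simp
  have nn: "0 \<le> derivative_ratio (word_map T u \<omega>) y"
    if "u \<in> lists alphabet" "\<omega> \<in> one_sided_shift" "y \<in> Ys" for u \<omega> y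
    using word_map_invariant(6)[OF that] by (simp add: conformal_at_def)
  have one: "derivative_ratio (word_map T u \<omega>) y \<le> L * L * word_scale u \<and>
       word_scale u \<le> L * L * derivative_ratio (word_map T u \<omega>) y"
    if "u \<in> lists alphabet" "\<omega> \<in> one_sided_shift" "y \<in> Ys" for u \<omega> y
    using cmp[OF that(1,2) base(1) that(3) base(2)] cmp[OF that(1) base(1) that(2) base(2) that(3)]
      mult_right_mono[OF L2 nn[OF that]] mult_right_mono[OF L2 nn[OF that(1) base]] unfolding word_scale_def by linarith
  have two: "word_scale (u @ v) \<le> L * L * (word_scale u * word_scale v) \<and>
       word_scale u * word_scale v \<le> L * L * word_scale (u @ v)"
    if u: "u \<in> lists alphabet" and v: "v \<in> lists alphabet" for u v
  proof -
    let ?o = "\<lambda>_. (1, 1)" and ?y = "SOME y. y \<in> Y"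
    let ?z = "word_map T v (prepend u ?o) ?y"
    have po: "prepend u ?o \<in> one_sided_shift" using prepend_in[OF u base(1)] .
    have z: "?z \<in> Ys" using word_map_invariant(1)[OF v po] base(2) by auto
    have eq: "word_scale (u @ v) = derivative_ratio (word_map T u ?o) ?z * derivative_ratio (word_map T v (prepend u ?o)) ?y"
      unfolding word_scale_def word_map_append
      by (intro conformal_at_compose(2) word_map_invariant(6) u v po z base)
    note n = nn[OF u base(1) z] nn[OF v po base(2)] word_scale_pos[OF u] word_scale_pos[OF v]
    have "word_scale (u @ v) \<le> (L * word_scale u) * (L * word_scale v)"
      unfolding eq using cmp[OF u base(1) base(1) z base(2)] cmp[OF v po base(1) base(2) base(2)] n L
      by (intro mult_mono) (auto simp: word_scale_def)
    moreover have "word_scale u * word_scale v \<le>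
       (L * derivative_ratio (word_map T u ?o) ?z) * (L * derivative_ratio (word_map T v (prepend u ?o)) ?y)"
      using cmp[OF u base(1) base(1) base(2) z] cmp[OF v base(1) po base(2) base(2)] n L
      by (intro mult_mono) (auto simp: word_scale_def)
    ultimately show ?thesis by (simp add: eq mult.assoc mult.left_commute)
  qed
  show thesis by (rule that[of "L * L"]) (use one two L mult_mono[of 1 L 1 L] in \<open>auto simp: distortion_constant_def\<close>)
qed

end

section \<open>Cylinders in the fibers\<close>

lemma prefix_of_concat_blocks:
  assumes "0 < n" "prefix (concat us) (concat vs)"
    "\<And>x. x \<in> set us \<union> set vs \<Longrightarrow> length x = n"
  shows "prefix us vs"
  using assms(2,3)
proof (induction us arbitrary: vs)
  case (Cons x us)
  have x: "length x = n" using Cons.prems(2) by simp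
  show ?case
  proof (cases vs)
    case Nil
    then show ?thesis using Cons.prems(1) x \<open>0 < n\<close> by auto
  next
    case (Cons y ws)
    then have y: "length y = n" using Cons.prems(2) by simp
    obtain zs where "x @ concat us @ zs = y @ concat ws"
      using Cons.prems(1) Cons by (auto simp: prefix_def)
    then have "x = y" "concat us @ zs = concat ws" using x y by auto
    then have "prefix (concat us) (concat ws)" by (metis prefixI)
    then have "prefix us ws" using Cons.IH[of ws] Cons.prems(2) Cons by auto
    then show ?thesis using \<open>x = y\<close> Cons by simp
  qed
qed simp

context conformal_Smale_skew_product
begin

definition words :: "nat \<Rightarrow> letter list set" where
  "words n = {u \<in> lists alphabet. length u = n}"

lemma word_scale_le_power:
  obtains q where "0 < q" "q < 1" "\<And>u. u \<in> lists alphabet \<Longrightarrow> word_scale u \<le> q ^ length u"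
proof -
  obtain q where q: "0 < q" "q < 1" "\<And>u \<omega> y. \<lbrakk>u \<in> lists alphabet; \<omega> \<in> one_sided_shift; y \<in> Ys\<rbrakk> \<Longrightarrow>
       derivative_ratio (word_map T u \<omega>) y \<le> q ^ length u"
    by (rule word_map_contraction) blast
  have "word_scale u \<le> q ^ length u" if "u \<in> lists alphabet" for u
    unfolding word_scale_def by (rule q(3)[OF that base_point_valid(2) subsetD[OF Ys_domain(4) base_point_valid(1)]])
  then show thesis using q that by blast
qed

text \<open>
  \<open>Y\<close> need not be convex or connected; the bound comes from the connectedness of \<open>Ys\<close> and the uniform
  constant in \<open>displacement_bound_on_compact\<close>.
\<close>

lemma cylinder_image_size:
  assumes "distortion_constant K"
  obtains C where "0 < C" "\<And>u \<omega> x y. \<lbrakk>u \<in> lists alphabet; \<omega> \<in> one_sided_shift; x \<in> Y; y \<in> Y\<rbrakk> \<Longrightarrow>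
    norm (word_map T u \<omega> x - word_map T u \<omega> y) \<le> C * word_scale u"
proof -
  obtain C where C: "0 \<le> C" "\<And>(f::complex \<Rightarrow> complex) d x y.
      \<lbrakk>\<And>z. z \<in> Ys \<Longrightarrow> f differentiable at z \<and> onorm (frechet_derivative f (at z)) \<le> d; x \<in> Y; y \<in> Y\<rbrakk>
      \<Longrightarrow> norm (f x - f y) \<le> C * d"
    by (rule displacement_bound_on_compact[OF Ys_domain(1,2) compact_Y Ys_domain(4)]) blast
  have K: "1 \<le> K" using assms by (simp add: distortion_constant_def)
  have "norm (word_map T u \<omega> x - word_map T u \<omega> y) \<le> (C * K + 1) * word_scale u"
    if u: "u \<in> lists alphabet" and \<omega>: "\<omega> \<in> one_sided_shift" and "x \<in> Y" "y \<in> Y" for u \<omega> x y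
  proof -
    have "norm (word_map T u \<omega> x - word_map T u \<omega> y) \<le> C * (K * word_scale u)"
    proof (rule C(2)[of "word_map T u \<omega>" "K * word_scale u"])
      fix z assume z: "z \<in> Ys"
      show "word_map T u \<omega> differentiable at z \<and> onorm (frechet_derivative (word_map T u \<omega>) (at z)) \<le> K * word_scale u"
        using word_map_invariant(6)[OF u \<omega> z] assms u \<omega> z
        unfolding distortion_constant_def conformal_at_def derivative_ratio_def[symmetric] by blast
    qed fact+
    then show ?thesis using word_scale_pos[OF u] by (simp add: algebra_simps)
  qed
  then show thesis using C(1) K by (intro that[of "C * K + 1"]) (auto intro: add_nonneg_pos)
qed

lemma fiber_limit_set_covered:
  assumes "\<omega> \<in> one_sided_shift"
  shows "fiber_limit_set T Y \<omega> \<subseteq> (\<Union>u\<in>words n. word_map T u \<omega> ` Y)"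
proof
  fix p assume "p \<in> fiber_limit_set T Y \<omega>"
  then obtain \<tau> where \<tau>: "\<tau> \<in> cylinder \<omega>" "p = fiber_coding T Y \<tau>" by (auto simp: fiber_limit_set_def)
  then have "\<tau> \<in> two_sided_shift" "tail_from 0 \<tau> = \<omega>" by (auto simp: cylinder_def)
  then show "p \<in> (\<Union>u\<in>words n. word_map T u \<omega> ` Y)"
    using fiber_coding_unique(1)[of \<tau> n] past_in_lists[of \<tau> n] \<tau>(2)
    by (intro UN_I[of "past \<tau> n"]) (auto simp: words_def fiber_composition_eq_word_map simp del: in_lists_conv_set)
qed

lemma fiber_limit_point_of_past:
  assumes "\<omega> \<in> one_sided_shift" "\<And>k. x k \<in> alphabet"
  obtains p where "p \<in> fiber_limit_set T Y \<omega>" "\<And>n. p \<in> word_map T (map x [0..<n]) \<omega> ` Y"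
proof -
  have g: "glue x \<omega> \<in> cylinder \<omega>" by (rule glue_in_cylinder) fact+
  then have "glue x \<omega> \<in> two_sided_shift" "tail_from 0 (glue x \<omega>) = \<omega>" by (auto simp: cylinder_def)
  then have "fiber_coding T Y (glue x \<omega>) \<in> word_map T (map x [0..<n]) \<omega> ` Y" for n
    using fiber_coding_unique(1)[of "glue x \<omega>" n] by (simp add: fiber_composition_eq_word_map past_glue)
  then show thesis using g by (intro that[of "fiber_coding T Y (glue x \<omega>)"]) (auto simp: fiber_limit_set_def)
qed

lemma fiber_limit_set_nonempty:
  assumes "\<omega> \<in> one_sided_shift" shows "fiber_limit_set T Y \<omega> \<noteq> {}"
  using fiber_limit_point_of_past[OF assms, of "\<lambda>_. (1, 1)"] by (auto simp: alphabet_def)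

text \<open>
  Strip the common beginning of \<open>u\<close> and \<open>v\<close> by injectivity; at the first letter where they differ
  \<open>T_disjoint\<close> applies, since the remaining maps preserve \<open>interior Y\<close>.
\<close>

lemma interior_images_disjoint:
  assumes "u \<in> lists alphabet" "v \<in> lists alphabet" "\<omega> \<in> one_sided_shift" "u \<parallel> v"
  shows "word_map T u \<omega> ` interior Y \<inter> word_map T v \<omega> ` interior Y = {}"
  using assms
proof (induction u arbitrary: v \<omega> rule: list.induct)
  case (Cons a u)
  obtain b w where v: "v = b # w" using Cons.prems(4) by (cases v) auto
  have a: "a \<in> alphabet" "u \<in> lists alphabet" and b: "b \<in> alphabet" "w \<in> lists alphabet"
    using Cons.prems v by auto
  let ?a = "concat_letter a \<omega>" and ?b = "concat_letter b \<omega>"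
  have \<omega>': "?a \<in> one_sided_shift" "?b \<in> one_sided_shift" using a b Cons.prems by (auto intro: concat_letter_in)
  note sub = word_map_invariant(3)[OF a(2) \<omega>'(1)] word_map_invariant(3)[OF b(2) \<omega>'(2)]
  show ?case
  proof (cases "a = b")
    case True
    then have "u \<parallel> w" using Cons.prems(4) v by (simp add: parallel_def)
    then have "word_map T u ?a ` interior Y \<inter> word_map T w ?a ` interior Y = {}"
      using Cons.IH a b \<omega>' by blast
    moreover have "interior Y \<subseteq> Ys" using Ys_domain(4) interior_subset by blast
    then have "inj_on (T ?a) (interior Y)" using T_homeo(1)[OF \<omega>'(1)] inj_on_subset by blast
    ultimately have "T ?a ` word_map T u ?a ` interior Y \<inter> T ?a ` word_map T w ?a ` interior Y = {}"
      using sub True by (subst inj_on_image_Int[symmetric]) auto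
    then show ?thesis using True v by (simp add: image_comp)
  next
    case False
    have "T ?a ` interior Y \<inter> T ?b ` interior Y = {}"
      using T_disjoint[OF Cons.prems(3) a(1) b(1) False] .
    then have "T ?a ` word_map T u ?a ` interior Y \<inter> T ?b ` word_map T w ?b ` interior Y = {}"
      using sub by blast
    then show ?thesis using v by (simp add: image_comp)
  qed
qed simp

section \<open>Upper estimate\<close>

text \<open>
  Submultiplicativity of the sums of \<open>word_scale u powr s\<close> over all words of a given length. Since these
  sums may be infinite, upper bounds on all finite partial sums are used instead of their values.
\<close>

lemma sum_scale_words_add:
  assumes K: "distortion_constant K" and "0 < s"
    and m: "\<And>G. finite G \<Longrightarrow> G \<subseteq> words m \<Longrightarrow> (\<Sum>u\<in>G. word_scale u powr s) \<le> a"
    and n: "\<And>G. finite G \<Longrightarrow> G \<subseteq> words n \<Longrightarrow> (\<Sum>u\<in>G. word_scale u powr s) \<le> b"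
    and G: "finite G" "G \<subseteq> words (m + n)"
  shows "(\<Sum>u\<in>G. word_scale u powr s) \<le> K powr s * (a * b)"
proof -
  let ?A = "take m ` G" and ?B = "drop m ` G"
  let ?g = "\<lambda>(v, w). K powr s * (word_scale v powr s * word_scale w powr s)"
  have split: "take m u \<in> words m \<and> drop m u \<in> words n" if "u \<in> G" for u
    using that G(2) by (fastforce simp: words_def dest: in_set_takeD in_set_dropD)
  have "0 \<le> a" using m[of "{}"] by simp
  have "(\<Sum>u\<in>G. word_scale u powr s) \<le> (\<Sum>u\<in>G. ?g (take m u, drop m u))"
  proof (rule sum_mono)
    fix u assume "u \<in> G"
    then have l: "take m u \<in> lists alphabet" "drop m u \<in> lists alphabet" using split by (auto simp: words_def)
    have "word_scale (take m u @ drop m u) \<le> K * (word_scale (take m u) * word_scale (drop m u))"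
      using K l unfolding distortion_constant_def by blast
    then have "word_scale u \<le> K * (word_scale (take m u) * word_scale (drop m u))" by simp
    then have "word_scale u powr s \<le> (K * (word_scale (take m u) * word_scale (drop m u))) powr s"
      using word_scale_pos[of u] \<open>u \<in> G\<close> G(2) \<open>0 < s\<close> by (intro powr_mono2) (auto simp: words_def intro: less_imp_le)
    also have "\<dots> = ?g (take m u, drop m u)"
      using word_scale_pos[OF l(1)] word_scale_pos[OF l(2)] K by (simp add: powr_mult distortion_constant_def)
    finally show "word_scale u powr s \<le> ?g (take m u, drop m u)" .
  qed
  also have "\<dots> = sum ?g ((\<lambda>u. (take m u, drop m u)) ` G)"
  proof -
    have "inj_on (\<lambda>u. (take m u, drop m u)) G"
      by (rule inj_onI) (metis append_take_drop_id prod.inject)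
    then show ?thesis by (simp add: sum.reindex)
  qed
  also have "\<dots> \<le> sum ?g (?A \<times> ?B)"
    using G(1) by (intro sum_mono2) auto
  also have "\<dots> = K powr s * ((\<Sum>v\<in>?A. word_scale v powr s) * (\<Sum>w\<in>?B. word_scale w powr s))"
  proof -
    have "(\<Sum>v\<in>?A. word_scale v powr s) * (\<Sum>w\<in>?B. word_scale w powr s) =
        (\<Sum>(v, w)\<in>?A \<times> ?B. word_scale v powr s * word_scale w powr s)"
      by (simp only: sum_product sum.cartesian_product)
    then show ?thesis by (simp add: sum_distrib_left split_def)
  qed
  also have "\<dots> \<le> K powr s * (a * b)"
    using m[of ?A] n[of ?B] G(1) split \<open>0 \<le> a\<close> by (intro mult_left_mono mult_mono) (auto intro: sum_nonneg)
  finally show ?thesis .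
qed

text \<open>
  The factor \<open>K powr (- s) / 2\<close> absorbs the constant in \<open>sum_scale_words_add\<close>, so the sums over
  words of length \<open>n * k\<close> are at most \<open>(1/2)^k\<close>. The cylinders of this length cover the fiber limit set
  and their diameters are at most a constant times the scales.
\<close>

lemma null_if_scale_sums_small:
  assumes K: "distortion_constant K" and "0 < s" "1 \<le> n" and \<omega>: "\<omega> \<in> one_sided_shift"
    and small: "\<And>G. finite G \<Longrightarrow> G \<subseteq> words n \<Longrightarrow> (\<Sum>u\<in>G. word_scale u powr s) \<le> K powr (- s) / 2"
  shows "hausdorff_measure s (fiber_limit_set T Y \<omega>) = 0"
proof (rule hausdorff_measure_eq_0I)
  fix d e :: real assume "0 < d" "0 < e"
  have K1: "1 \<le> K" using K by (simp add: distortion_constant_def)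
  have iter: "(\<Sum>u\<in>G. word_scale u powr s) \<le> (1 / 2) ^ k" if "finite G" "G \<subseteq> words (n * k)" for k G
    using that
  proof (induction k arbitrary: G)
    case 0
    then have "G \<subseteq> {[]}" by (auto simp: words_def)
    then have "G = {} \<or> G = {[]}" by blast
    then show ?case by (auto simp: word_scale_Nil)
  next
    case (Suc k)
    have "(\<Sum>u\<in>G. word_scale u powr s) \<le> K powr s * (K powr (- s) / 2 * (1 / 2) ^ k)"
      by (rule sum_scale_words_add[OF K \<open>0 < s\<close> small Suc.IH]) (use Suc.prems in auto)
    also have "\<dots> = (1 / 2) ^ Suc k" using K1 by (simp add: powr_minus field_simps)
    finally show ?case .
  qed
  obtain C where C: "0 < C" "\<And>u \<omega> x y. \<lbrakk>u \<in> lists alphabet; \<omega> \<in> one_sided_shift; x \<in> Y; y \<in> Y\<rbrakk> \<Longrightarrow>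
    norm (word_map T u \<omega> x - word_map T u \<omega> y) \<le> C * word_scale u"
    by (rule cylinder_image_size[OF K]) blast
  obtain q where q: "0 < q" "q < 1" "\<And>u. u \<in> lists alphabet \<Longrightarrow> word_scale u \<le> q ^ length u"
    by (rule word_scale_le_power) blast
  obtain k where k: "C * q ^ k < d" "C powr s * (1 / 2) ^ k < e"
  proof -
    have "(\<lambda>k. C * q ^ k) \<longlonglongrightarrow> C * 0" using q by (intro tendsto_intros LIMSEQ_power_zero) auto
    then have "eventually (\<lambda>k. C * q ^ k < d) sequentially" using \<open>0 < d\<close> by (intro order_tendstoD) auto
    moreover have "(\<lambda>k. C powr s * (1 / 2) ^ k) \<longlonglongrightarrow> C powr s * 0" by (intro tendsto_intros LIMSEQ_power_zero) auto
    then have "eventually (\<lambda>k. C powr s * (1 / 2) ^ k < e) sequentially" using \<open>0 < e\<close> by (intro order_tendstoD) auto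
    ultimately show thesis using that eventually_happens'[OF sequentially_bot eventually_conj] by blast
  qed
  \<comment> \<open>The cover has to be a sequence. Only indices that are codes of words are used, as \<open>from_nat\<close> is injective on these.\<close>
  define code where "code = {i. from_nat i \<in> words (n * k) \<and> to_nat (from_nat i :: letter list) = i}"
  define E where "E = (\<lambda>i. if i \<in> code then word_map T (from_nat i) \<omega> ` Y else {})"
  have wl: "from_nat i \<in> lists alphabet" "word_scale (from_nat i) \<le> q ^ k" if "i \<in> code" for i
  proof -
    show l: "from_nat i \<in> lists alphabet" using that by (simp add: code_def words_def)
    have "word_scale (from_nat i) \<le> q ^ (n * k)" using q(3)[OF l] that by (simp add: code_def words_def)
    also have "\<dots> \<le> q ^ k" using q \<open>1 \<le> n\<close> by (intro power_decreasing) auto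
    finally show "word_scale (from_nat i) \<le> q ^ k" .
  qed
  have size: "norm (x - y) \<le> C * word_scale (from_nat i)" if "i \<in> code" "x \<in> E i" "y \<in> E i" for i x y
    using that C(2)[OF wl(1)[OF that(1)] \<omega>] by (auto simp: E_def)
  have diam: "bounded (E i) \<and> diameter (E i) \<le> C * word_scale (from_nat i)" if "i \<in> code" for i
  proof
    show "bounded (E i)" using size[OF that] unfolding bounded_two_points dist_norm by blast
    show "diameter (E i) \<le> C * word_scale (from_nat i)"
      using size[OF that] C(1) word_scale_pos[OF wl(1)[OF that]] by (intro diameter_le) auto
  qed
  have "fiber_limit_set T Y \<omega> \<subseteq> (\<Union>i. E i)"
  proof
    fix p assume "p \<in> fiber_limit_set T Y \<omega>"
    then obtain u where "u \<in> words (n * k)" "p \<in> word_map T u \<omega> ` Y"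
      using fiber_limit_set_covered[OF \<omega>, of "n * k"] by blast
    then show "p \<in> (\<Union>i. E i)" by (intro UN_I[of "to_nat u"]) (auto simp: E_def code_def)
  qed
  moreover have "bounded (E i) \<and> diameter (E i) \<le> d" for i
  proof (cases "i \<in> code")
    case True
    have "C * word_scale (from_nat i) \<le> C * q ^ k" using wl(2)[OF True] C(1) by simp
    then show ?thesis using diam[OF True] k(1) by linarith
  next
    case False
    then show ?thesis using \<open>0 < d\<close> by (simp add: E_def diameter_def)
  qed
  moreover have "(\<Sum>i. hausdorff_weight s (E i)) \<le> ennreal e"
  proof -
    have w: "hausdorff_weight s (E i) \<le> (if i \<in> code then ennreal (C powr s * word_scale (from_nat i) powr s) else 0)" for i
    proof (cases "i \<in> code")
      case True
      have "diameter (E i) powr s \<le> (C * word_scale (from_nat i)) powr s"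
        using diam[OF True] \<open>0 < s\<close> by (intro powr_mono2) (auto intro: diameter_ge_0)
      also have "\<dots> = C powr s * word_scale (from_nat i) powr s"
        using C(1) word_scale_pos[OF wl(1)[OF True]] by (simp add: powr_mult)
      finally show ?thesis using True \<open>0 < s\<close> by (auto simp: hausdorff_weight_def intro: ennreal_leI)
    qed (simp add: E_def hausdorff_weight_def)
    have "(\<Sum>i<N. hausdorff_weight s (E i)) \<le> ennreal e" for N
    proof -
      let ?I = "{i. i < N \<and> i \<in> code}"
      have inj: "inj_on (from_nat :: nat \<Rightarrow> letter list) ?I"
        by (rule inj_on_inverseI[of _ to_nat]) (simp add: code_def)
      have "(\<Sum>i<N. hausdorff_weight s (E i)) \<le> (\<Sum>i<N. if i \<in> code then ennreal (C powr s * word_scale (from_nat i) powr s) else 0)"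
        by (intro sum_mono w)
      also have "\<dots> = (\<Sum>i\<in>?I. ennreal (C powr s * word_scale (from_nat i) powr s))"
        by (simp add: sum.If_cases Int_def)
      also have "\<dots> = ennreal (C powr s * (\<Sum>i\<in>?I. word_scale (from_nat i) powr s))"
        by (subst sum_ennreal) (auto simp: sum_distrib_left)
      also have "(\<Sum>i\<in>?I. word_scale (from_nat i) powr s) = (\<Sum>u\<in>from_nat ` ?I. word_scale u powr s)"
        by (simp add: sum.reindex[OF inj] o_def)
      also have "ennreal (C powr s * \<dots>) \<le> ennreal (C powr s * (1 / 2) ^ k)"
        by (intro ennreal_leI mult_left_mono iter) (auto simp: code_def)
      also have "\<dots> \<le> ennreal e" using k(2) by (intro ennreal_leI) auto
      finally show ?thesis .
    qed
    then show ?thesis unfolding suminf_eq_SUP by (rule SUP_least)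
  qed
  ultimately show "\<exists>E :: nat \<Rightarrow> complex set. fiber_limit_set T Y \<omega> \<subseteq> (\<Union>i. E i) \<and>
     (\<forall>i. bounded (E i) \<and> diameter (E i) \<le> d) \<and> (\<Sum>i. hausdorff_weight s (E i)) \<le> ennreal e"
    by blast
qed

section \<open>Lower estimate\<close>

text \<open>
  The sequences of blocks from \<open>F\<close> at which the scale first drops to \<open>d\<close> or below, and whose cylinder
  meets \<open>E\<close>. Scales need not decrease along prefixes, so ``first'' refers to all proper prefixes; this
  keeps distinct stopping words incomparable.
\<close>

definition stopping_words :: "letter list set \<Rightarrow> (nat \<Rightarrow> letter) \<Rightarrow> real \<Rightarrow> complex set \<Rightarrow> letter list list set" where
  "stopping_words F \<omega> d E = {us. set us \<subseteq> F \<and> word_scale (concat us) \<le> d \<and>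
     (\<forall>ps. strict_prefix ps us \<longrightarrow> d < word_scale (concat ps)) \<and>
     word_map T (concat us) \<omega> ` Y \<inter> E \<noteq> {}}"

lemma concat_in_lists: "set us \<subseteq> words n \<Longrightarrow> concat us \<in> lists alphabet"
  unfolding words_def by fastforce

text \<open>
  If \<open>E\<close> has diameter at most \<open>d\<close>, the cylinders of stopping words have diameter at most a multiple
  of \<open>d\<close>, so they lie within a multiple of \<open>d\<close> from \<open>E\<close>. The last block costs at most the factor \<open>c / K\<close>, where
  \<open>c\<close> is the least scale in \<open>F\<close>, so each image of \<open>interior Y\<close> contains a disc of radius \<open>d * \<kappa>\<close>. These
  images are disjoint, and a packing argument bounds their number independently of \<open>d\<close>, \<open>E\<close> and \<open>\<omega>\<close>.
\<close>

lemma card_stopping_words_bounded: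
  assumes K: "distortion_constant K" and "1 \<le> n" and F: "finite F" "F \<noteq> {}" "F \<subseteq> words n"
  obtains N :: nat where "1 \<le> N"
    "\<And>\<omega> E d. \<lbrakk>\<omega> \<in> one_sided_shift; bounded E; diameter E \<le> d; 0 < d; d < 1\<rbrakk> \<Longrightarrow>
       finite (stopping_words F \<omega> d E) \<and> card (stopping_words F \<omega> d E) \<le> N"
proof -
  have K1: "1 \<le> K" using K by (simp add: distortion_constant_def)
  obtain C where C: "0 < C" "\<And>u \<omega> x y. \<lbrakk>u \<in> lists alphabet; \<omega> \<in> one_sided_shift; x \<in> Y; y \<in> Y\<rbrakk> \<Longrightarrow>
    norm (word_map T u \<omega> x - word_map T u \<omega> y) \<le> C * word_scale u"
    by (rule cylinder_image_size[OF K]) blast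
  obtain x0 where "x0 \<in> interior Y" using Y_interior by blast
  then obtain \<rho> where \<rho>: "0 < \<rho>" "ball x0 \<rho> \<subseteq> interior Y" using open_interior openE by blast
  have x0: "x0 \<in> Y" using \<open>x0 \<in> interior Y\<close> interior_subset by blast
  have bY: "ball x0 \<rho> \<subseteq> Ys" using \<rho>(2) Ys_domain(4) interior_subset by blast
  define c where "c = Min (word_scale ` F)"
  have "0 < word_scale f" if "f \<in> F" for f
    using that F(3) word_scale_pos unfolding words_def by blast
  then have c: "0 < c" "\<And>f. f \<in> F \<Longrightarrow> c \<le> word_scale f"
    using F(1,2) by (auto simp: c_def)
  define \<kappa> where "\<kappa> = \<rho> * c / K\<^sup>2"
  have \<kappa>: "0 < \<kappa>" using \<rho> c K1 by (simp add: \<kappa>_def)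
  define N where "N = nat \<lfloor>((C + 1 + \<kappa>) / \<kappa>)\<^sup>2\<rfloor>"
  have main: "card A \<le> N"
    if A: "A \<subseteq> stopping_words F \<omega> d E" "finite A" and \<omega>: "\<omega> \<in> one_sided_shift"
      and E: "bounded E" "diameter E \<le> d" and d: "0 < d" "d < 1" for A \<omega> E d
  proof (cases "E = {}")
    case True
    then have "A = {}" using A(1) by (auto simp: stopping_words_def)
    then show ?thesis by simp
  next
    case False
    then obtain e where e: "e \<in> E" by blast
    let ?f = "\<lambda>us. word_map T (concat us) \<omega>"
    have us: "set us \<subseteq> F" "word_scale (concat us) \<le> d" "concat us \<in> lists alphabet"
      "\<And>ps. strict_prefix ps us \<Longrightarrow> d < word_scale (concat ps)" "?f us ` Y \<inter> E \<noteq> {}"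
      if "us \<in> A" for us
      using A(1) that F(3) concat_in_lists[of us n] unfolding stopping_words_def by blast+
    have lower: "d * \<kappa> \<le> word_scale (concat us) / K * \<rho>" if "us \<in> A" for us
    proof -
      have "us \<noteq> []" using us(2)[OF that] d by (auto simp: word_scale_Nil)
      then obtain ps f where pf: "us = ps @ [f]" by (metis rev_exhaust)
      then have f: "f \<in> F" "set ps \<subseteq> F" using us(1)[OF that] by auto
      then have l: "f \<in> lists alphabet" "concat ps \<in> lists alphabet"
        using F(3) concat_in_lists[of ps n] by (auto simp: words_def)
      have "d < word_scale (concat ps)" by (rule us(4)[OF that]) (simp add: pf strict_prefix_def)
      then have "d * c \<le> word_scale (concat ps) * word_scale f"
        using c(2)[OF f(1)] c(1) d by (intro mult_mono) auto
      also have "\<dots> \<le> K * word_scale (concat ps @ f)" using K l unfolding distortion_constant_def by blast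
      finally have "d * c \<le> K * word_scale (concat us)" using pf by simp
      then have "d * c / K \<le> word_scale (concat us)" using K1 by (simp add: field_simps)
      then have "d * c / K / K * \<rho> \<le> word_scale (concat us) / K * \<rho>"
        using K1 \<rho> by (intro mult_right_mono divide_right_mono) auto
      then show ?thesis by (simp add: \<kappa>_def power2_eq_square algebra_simps)
    qed
    have ball: "ball (?f us x0) (d * \<kappa>) \<subseteq> ?f us ` interior Y" if "us \<in> A" for us
    proof -
      have "ball (?f us x0) (word_scale (concat us) / K * \<rho>) \<subseteq> ?f us ` ball x0 \<rho>"
      proof (rule ball_subset_image_of_expanding)
        fix x v assume "x \<in> ball x0 \<rho>"
        then have x: "x \<in> Ys" using bY by blast
        note conf = word_map_invariant(6)[OF us(3)[OF that] \<omega> x]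
        show "(?f us has_derivative frechet_derivative (?f us) (at x)) (at x)"
          using conf by (simp add: conformal_at_def frechet_derivative_works[symmetric])
        have "word_scale (concat us) \<le> K * derivative_ratio (?f us) x"
          using K us(3)[OF that] \<omega> x unfolding distortion_constant_def by blast
        then have "word_scale (concat us) / K \<le> derivative_ratio (?f us) x" using K1 by (simp add: field_simps)
        then show "word_scale (concat us) / K * norm v \<le> norm (frechet_derivative (?f us) (at x) v)"
          using conf mult_right_mono[of _ _ "norm v"] by (auto simp only: conformal_at_def norm_ge_zero)
      next
        show "inj_on (?f us) (ball x0 \<rho>)"
          using word_map_invariant(4)[OF us(3)[OF that] \<omega>] bY inj_on_subset by blast
        show "0 < word_scale (concat us) / K" using word_scale_pos[OF us(3)[OF that]] K1 by simp
      qed fact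
      moreover have "ball (?f us x0) (d * \<kappa>) \<subseteq> ball (?f us x0) (word_scale (concat us) / K * \<rho>)"
        using lower[OF that] by (rule subset_ball)
      ultimately show ?thesis using \<rho>(2) by blast
    qed
    have "real (card A) \<le> (((C + 1) * d + d * \<kappa>) / (d * \<kappa>))\<^sup>2"
    proof (rule card_disjoint_balls_le[OF \<open>finite A\<close>, where p = "\<lambda>us. ?f us x0" and c = e])
      fix us assume A1: "us \<in> A"
      obtain y where y: "y \<in> Y" "?f us y \<in> E" using us(5)[OF A1] by blast
      have "dist (?f us x0) (?f us y) \<le> C * word_scale (concat us)"
        using C(2)[OF us(3)[OF A1] \<omega> x0 y(1)] by (simp add: dist_norm)
      also have "\<dots> \<le> C * d" using us(2)[OF A1] C(1) by simp
      finally have "dist (?f us x0) (?f us y) \<le> C * d" .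
      moreover have "dist (?f us y) e \<le> d" using diameter_bounded_bound[OF E(1) y(2) e] E(2) by simp
      ultimately show "dist (?f us x0) e \<le> (C + 1) * d"
        using dist_triangle[of "?f us x0" e "?f us y"] by (simp add: algebra_simps)
      fix vs assume A2: "vs \<in> A" "us \<noteq> vs"
      have "\<not> prefix us vs" "\<not> prefix vs us"
        using us(2)[OF A1] us(2)[OF A2(1)] us(4)[OF A1, of vs] us(4)[OF A2(1), of us] A2(2)
        by (auto simp: strict_prefix_def)
      moreover have "length x = n" if "x \<in> set us \<union> set vs" for x
        using us(1)[OF A1] us(1)[OF A2(1)] F(3) that by (auto simp: words_def)
      ultimately have "concat us \<parallel> concat vs"
        using prefix_of_concat_blocks[of n us vs] prefix_of_concat_blocks[of n vs us] \<open>1 \<le> n\<close>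
        by (intro parallelI) (auto simp: Un_commute)
      then show "ball (?f us x0) (d * \<kappa>) \<inter> ball (?f vs x0) (d * \<kappa>) = {}"
        using interior_images_disjoint[OF us(3)[OF A1] us(3)[OF A2(1)] \<omega>] ball[OF A1] ball[OF A2(1)] by blast
    qed (use C d \<kappa> in auto)
    also have "((C + 1) * d + d * \<kappa>) / (d * \<kappa>) = (C + 1 + \<kappa>) / \<kappa>" using d \<kappa> by (simp add: field_simps)
    finally show ?thesis unfolding N_def by (simp add: le_nat_floor)
  qed
  show thesis
  proof (rule that[of "Suc N"])
    fix \<omega> and E :: "complex set" and d :: real
    assume "\<omega> \<in> one_sided_shift" "bounded E" "diameter E \<le> d" "0 < d" "d < 1"
    then have "finite (stopping_words F \<omega> d E) \<and> card (stopping_words F \<omega> d E) \<le> N"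
      by (intro finite_if_finite_subsets_card_bdd main)
    then show "finite (stopping_words F \<omega> d E) \<and> card (stopping_words F \<omega> d E) \<le> Suc N" by simp
  qed simp
qed

text \<open>
  A branch of blocks spells a past \<open>y\<close>, whose coded point \<open>p\<close> lies in some \<open>E i\<close>. As scales tend to 0 along the
  branch, there is a first prefix of scale at most \<open>d i\<close>, and its cylinder contains \<open>p\<close>.
\<close>

lemma stopping_words_bar:
  assumes \<omega>: "\<omega> \<in> one_sided_shift" and "1 \<le> n" and F: "F \<subseteq> words n"
    and x: "range x \<subseteq> F" and cover: "fiber_limit_set T Y \<omega> \<subseteq> (\<Union>i. E i)" and d: "\<And>i::nat. 0 < d i"
  shows "\<exists>k i. map x [0..<k] \<in> stopping_words F \<omega> (d i) (E i)"
proof -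
  define y where "y = (\<lambda>j. x (j div n) ! (j mod n))"
  have xw: "x k \<in> words n" for k using x F by auto
  have "y j \<in> alphabet" for j
    using xw[of "j div n"] nth_mem[of "j mod n" "x (j div n)"] \<open>1 \<le> n\<close> by (auto simp: y_def words_def)
  then obtain p where p: "p \<in> fiber_limit_set T Y \<omega>" "\<And>n. p \<in> word_map T (map y [0..<n]) \<omega> ` Y"
    using fiber_limit_point_of_past[OF \<omega>] by blast
  have flat: "map y [0..<n * k] = concat (map x [0..<k])" for k
  proof (induction k)
    case (Suc k)
    have "map y [n * k..<n * k + n] = x k"
      by (rule nth_equalityI) (use xw[of k] \<open>1 \<le> n\<close> in \<open>auto simp: y_def words_def\<close>)
    moreover have "[0..<n * Suc k] = [0..<n * k] @ [n * k..<n * k + n]"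
      using upt_add_eq_append[of 0 "n * k" n] by (simp add: add.commute)
    ultimately show ?case using Suc by simp
  qed simp
  obtain i where i: "p \<in> E i" using p(1) cover by blast
  obtain q where q: "0 < q" "q < 1" "\<And>u. u \<in> lists alphabet \<Longrightarrow> word_scale u \<le> q ^ length u"
    by (rule word_scale_le_power) blast
  define P where "P = (\<lambda>k. word_scale (concat (map x [0..<k])) \<le> d i)"
  have "\<exists>k. P k"
  proof -
    obtain k where k: "q ^ k < d i" using real_arch_pow_inv[OF d q(2)] by blast
    have "concat (map x [0..<k]) \<in> lists alphabet" using x F by (intro concat_in_lists[of _ n]) auto
    from q(3)[OF this] have "word_scale (concat (map x [0..<k])) \<le> q ^ length (map y [0..<n * k])" by (simp only: flat)
    also have "\<dots> \<le> q ^ k" using q \<open>1 \<le> n\<close> by (intro power_decreasing) auto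
    finally show ?thesis using k unfolding P_def by (intro exI[of _ k]) linarith
  qed
  then obtain k where k: "P k" "\<And>j. j < k \<Longrightarrow> \<not> P j" using exists_least_iff[of P] by blast
  have "d i < word_scale (concat ps)" if "strict_prefix ps (map x [0..<k])" for ps
  proof -
    have l: "length ps < k" using prefix_length_less[OF that] by simp
    obtain zs where "map x [0..<k] = ps @ zs" using \<open>strict_prefix ps _\<close> by (auto simp: strict_prefix_def prefix_def)
    then have "ps = take (length ps) (map x [0..<k])" by simp
    also have "\<dots> = map x [0..<length ps]" using l by (simp add: take_map)
    finally show ?thesis using k(2)[OF l] by (simp add: P_def)
  qed
  moreover have "word_map T (concat (map x [0..<k])) \<omega> ` Y \<inter> E i \<noteq> {}" using p(2)[of "n * k"] i unfolding flat by blast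
  ultimately show ?thesis using k(1) x unfolding stopping_words_def P_def by (intro exI[of _ k] exI[of _ i]) auto
qed

text \<open>
  By the choice of \<open>F\<close>, the weight \<open>word_scale u powr s\<close> of a sequence of blocks from \<open>F\<close> is at most the total
  weight of its children: the constant \<open>K powr s\<close> lost by quasi-multiplicativity is regained from the
  sum over \<open>F\<close>. A cover by sets \<open>E i\<close> yields a bar made of stopping words at scale comparable to
  \<open>diameter (E i)\<close>, with at most \<open>N\<close> of them for each \<open>i\<close>. Since the bar weighs at least 1, the
  \<open>s\<close>-weight of the cover is bounded below.
\<close>

lemma positive_if_scale_sum_large:
  assumes K: "distortion_constant K" and s: "0 < s" and n: "1 \<le> n" and \<omega>: "\<omega> \<in> one_sided_shift"
    and F: "finite F" "F \<subseteq> words n" and large: "K powr s \<le> (\<Sum>u\<in>F. word_scale u powr s)"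
  shows "hausdorff_measure s (fiber_limit_set T Y \<omega>) \<noteq> 0"
proof
  assume null: "hausdorff_measure s (fiber_limit_set T Y \<omega>) = 0"
  have K1: "1 \<le> K" using K by (simp add: distortion_constant_def)
  have "F \<noteq> {}" using large K1 by auto
  obtain N :: nat where N: "1 \<le> N"
    "\<And>E d. \<lbrakk>bounded E; diameter E \<le> d; 0 < d; d < 1\<rbrakk> \<Longrightarrow>
       finite (stopping_words F \<omega> d E) \<and> card (stopping_words F \<omega> d E) \<le> N"
    by (rule card_stopping_words_bounded[OF K n F(1) \<open>F \<noteq> {}\<close> F(2)]) (use \<omega> in blast)
  \<comment> \<open>\<open>N * (\<eta> + \<eta>) = 1/2\<close>, which is less than the weight 1 of the root; one \<open>\<eta>\<close> is for the cover, the other for the \<open>t i\<close> below.\<close>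
  define \<eta> where "\<eta> = 1 / (4 * real N)"
  have \<eta>: "0 < \<eta>" "\<eta> < 1" using N(1) by (auto simp: \<eta>_def field_simps)
  have "hausdorff_premeasure s (1 / 2) (fiber_limit_set T Y \<omega>) \<le> hausdorff_measure s (fiber_limit_set T Y \<omega>)"
    unfolding hausdorff_measure_def by (rule SUP_upper) simp
  then have "hausdorff_premeasure s (1 / 2) (fiber_limit_set T Y \<omega>) < ennreal \<eta>" using null \<eta> by simp
  then obtain E :: "nat \<Rightarrow> complex set" where cover: "fiber_limit_set T Y \<omega> \<subseteq> (\<Union>i. E i)"
    and E: "\<And>i. bounded (E i)" "\<And>i. diameter (E i) \<le> 1 / 2" and sumE: "(\<Sum>i. hausdorff_weight s (E i)) < ennreal \<eta>"
    unfolding hausdorff_premeasure_def INF_less_iff by blast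
  define t where "t = (\<lambda>i::nat. \<eta> * (1 / 2) ^ Suc i)"
  have t: "0 < t i" "t i < 1" for i
  proof -
    show "0 < t i" using \<eta> by (simp add: t_def)
    have "t i \<le> \<eta> * 1" unfolding t_def using \<eta> by (intro mult_left_mono power_le_one) auto
    then show "t i < 1" using \<eta> by simp
  qed
  \<comment> \<open>Covering sets may have diameter 0, but stopping needs a positive threshold: raise the diameter so that its \<open>s\<close>-th power grows by at most \<open>t i\<close>.\<close>
  define d where "d = (\<lambda>i. max (diameter (E i)) (t i powr (1 / s)))"
  have d: "diameter (E i) \<le> d i" "0 < d i" "d i < 1" for i
  proof -
    have "t i powr (1 / s) < 1" using powr_less_mono2[of "1 / s" "t i" 1] t[of i] s by simp
    then show "d i < 1" using E(2)[of i] by (simp add: d_def)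
    have "0 < t i powr (1 / s)" using t(1)[of i] by simp
    then show "0 < d i" unfolding d_def by (rule less_le_trans) simp
    show "diameter (E i) \<le> d i" by (simp add: d_def)
  qed
  define W where "W = (\<lambda>us. ennreal (word_scale (concat us) powr s))"
  let ?C = "\<lambda>i. stopping_words F \<omega> (d i) (E i)"
  have C: "finite (?C i) \<and> card (?C i) \<le> N" for i by (rule N(2)) (use E d in auto)
  have "W [] \<le> (\<Sum>i. \<Sum>us\<in>?C i. W us)"
  proof (rule root_weight_le_weight_of_bar)
    fix us assume "set us \<subseteq> F"
    then have l: "concat us \<in> lists alphabet" using F(2) concat_in_lists by blast
    let ?u = "concat us"
    have "K powr s * word_scale ?u powr s \<le> (\<Sum>v\<in>F. word_scale v powr s) * word_scale ?u powr s"
      using large by (rule mult_right_mono) simp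
    also have "\<dots> = (\<Sum>v\<in>F. word_scale ?u powr s * word_scale v powr s)"
      unfolding sum_distrib_right by (rule sum.cong) (simp_all add: mult.commute)
    also have "\<dots> \<le> (\<Sum>v\<in>F. K powr s * word_scale (?u @ v) powr s)"
    proof (rule sum_mono)
      fix v assume "v \<in> F"
      then have v: "v \<in> lists alphabet" using F(2) by (auto simp: words_def)
      have "word_scale ?u * word_scale v \<le> K * word_scale (?u @ v)"
        using K l v unfolding distortion_constant_def by blast
      then have "(word_scale ?u * word_scale v) powr s \<le> (K * word_scale (?u @ v)) powr s"
        using word_scale_pos[OF l] word_scale_pos[OF v] s by (intro powr_mono2) auto
      then show "word_scale ?u powr s * word_scale v powr s \<le> K powr s * word_scale (?u @ v) powr s"
        using word_scale_pos[OF l] word_scale_pos[OF v] word_scale_pos[of "?u @ v"] l v K1 by (simp add: powr_mult)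
    qed
    finally have "K powr s * word_scale ?u powr s \<le> K powr s * (\<Sum>v\<in>F. word_scale (?u @ v) powr s)"
      by (simp add: sum_distrib_left)
    then have "word_scale ?u powr s \<le> (\<Sum>v\<in>F. word_scale (?u @ v) powr s)" using K1 by simp
    then show "W us \<le> (\<Sum>v\<in>F. W (us @ [v]))" by (simp add: W_def sum_ennreal ennreal_leI)
  next
    show "\<exists>k i. map x [0..<k] \<in> ?C i" if "range x \<subseteq> F" for x
      using stopping_words_bar[OF \<omega> n F(2) that cover d(2)] .
  qed (use F C in auto)
  also have "\<dots> \<le> (\<Sum>i. of_nat N * (hausdorff_weight s (E i) + ennreal (t i)))"
  proof (intro suminf_le allI)
    fix i
    show "(\<Sum>us\<in>?C i. W us) \<le> of_nat N * (hausdorff_weight s (E i) + ennreal (t i))"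
    proof (cases "E i = {}")
      case True
      then have "?C i = {}" by (auto simp: stopping_words_def)
      then show ?thesis by simp
    next
      case False
      have le: "d i powr s \<le> diameter (E i) powr s + t i"
      proof (cases "diameter (E i) \<le> t i powr (1 / s)")
        case True
        then have "d i powr s = t i" using s t(1)[of i] by (simp add: d_def powr_powr)
        then show ?thesis by simp
      next
        case False
        then show ?thesis using t(1)[of i] by (simp add: d_def)
      qed
      have "W us \<le> hausdorff_weight s (E i) + ennreal (t i)" if "us \<in> ?C i" for us
      proof -
        have "set us \<subseteq> F" "word_scale (concat us) \<le> d i" using that by (auto simp: stopping_words_def)
        moreover have "concat us \<in> lists alphabet" using \<open>set us \<subseteq> F\<close> F(2) concat_in_lists by blast
        ultimately have "word_scale (concat us) powr s \<le> d i powr s"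
          using word_scale_pos[of "concat us"] s by (intro powr_mono2) auto
        also note le
        finally have "W us \<le> ennreal (diameter (E i) powr s + t i)" by (simp add: W_def ennreal_leI)
        also have "\<dots> = ennreal (diameter (E i) powr s) + ennreal (t i)"
          using t(1)[of i] by (intro ennreal_plus) auto
        finally show ?thesis using False s by (simp add: hausdorff_weight_def)
      qed
      then have "(\<Sum>us\<in>?C i. W us) \<le> of_nat (card (?C i)) * (hausdorff_weight s (E i) + ennreal (t i))"
        by (rule sum_bounded_above)
      also have "\<dots> \<le> of_nat N * (hausdorff_weight s (E i) + ennreal (t i))"
        using C[of i] by (intro mult_right_mono) auto
      finally show ?thesis .
    qed
  qed simp_all
  also have "\<dots> = of_nat N * ((\<Sum>i. hausdorff_weight s (E i)) + (\<Sum>i. ennreal (t i)))"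
    by (simp add: ennreal_suminf_cmult suminf_add)
  also have "(\<Sum>i. ennreal (t i)) = ennreal \<eta>"
  proof -
    have "t sums (\<eta> * 1)" unfolding t_def by (intro sums_mult power_half_series)
    then show ?thesis using t(1) by (intro suminf_ennreal_eq) (auto intro: less_imp_le)
  qed
  also have "of_nat N * ((\<Sum>i. hausdorff_weight s (E i)) + ennreal \<eta>) \<le> of_nat N * (ennreal \<eta> + ennreal \<eta>)"
    using sumE by (intro mult_left_mono add_right_mono) auto
  also have "\<dots> = ennreal (real N * (\<eta> + \<eta>))"
    by (simp only: ennreal_of_nat_eq_real_of_nat ennreal_plus ennreal_mult of_nat_0_le_iff
        add_nonneg_nonneg less_imp_le[OF \<eta>(1)])
  also have "real N * (\<eta> + \<eta>) = 1 / 2" using N(1) by (simp add: \<eta>_def)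
  finally have "ennreal 1 \<le> ennreal (1 / 2)" by (simp add: W_def word_scale_Nil)
  then show False by (subst (asm) ennreal_le_iff) auto
qed

section \<open>Comparison of fibers\<close>

text \<open>
  If the measure of exponent \<open>s\<close> is nonzero in some fiber, the sums of exponent \<open>s\<close> are bounded below by
  \<open>K powr (- s) / 2\<close> for all lengths \<open>n\<close>. Lowering the exponent to \<open>r\<close> multiplies each term by at least
  \<open>p^(-n)\<close> with \<open>p = q powr (s - r) < 1\<close>, so for large \<open>n\<close> finitely many words give a sum of at least
  \<open>K powr r\<close>; then the measure of exponent \<open>r\<close> is positive in every fiber. Neither condition on the
  sums mentions the fiber. The case \<open>r = 0\<close> is separate because the lower estimate needs a
  positive exponent.
\<close>

lemma null_in_one_fiber_imp_null_in_all:
  assumes \<omega>: "\<omega> \<in> one_sided_shift" "\<omega>' \<in> one_sided_shift" and "0 \<le> r" "r < s"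
    and null: "hausdorff_measure r (fiber_limit_set T Y \<omega>') = 0"
  shows "hausdorff_measure s (fiber_limit_set T Y \<omega>) = 0"
proof (rule ccontr)
  assume pos: "hausdorff_measure s (fiber_limit_set T Y \<omega>) \<noteq> 0"
  have "r \<noteq> 0" using null hausdorff_measure_0_nonzero[OF fiber_limit_set_nonempty[OF \<omega>(2)]] by auto
  then have "0 < r" "0 < s" using assms by auto
  obtain K where K: "distortion_constant K" by (rule distortion_constant_exists)
  have K1: "1 \<le> K" using K by (simp add: distortion_constant_def)
  obtain q where q: "0 < q" "q < 1" "\<And>u. u \<in> lists alphabet \<Longrightarrow> word_scale u \<le> q ^ length u"
    by (rule word_scale_le_power) blast
  define p where "p = q powr (s - r)"
  have p: "0 < p" "p < 1" using q \<open>r < s\<close> powr_less_mono2[of "s - r" q 1] by (auto simp: p_def)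
  define b where "b = K powr (- s) / 2 / K powr r"
  have "0 < b" using K1 by (simp add: b_def)
  then obtain m where m: "p ^ m < b" using real_arch_pow_inv p(2) by blast
  define n where "n = Suc m"
  have "p ^ n \<le> p ^ m" using p by (simp add: n_def mult_left_le_one_le)
  then have n: "p ^ n < b" "1 \<le> n" using m by (auto simp: n_def)
  obtain G where G: "finite G" "G \<subseteq> words n" "K powr (- s) / 2 < (\<Sum>u\<in>G. word_scale u powr s)"
    using null_if_scale_sums_small[OF K \<open>0 < s\<close> n(2) \<omega>(1)] pos by (meson not_le)
  have "(\<Sum>u\<in>G. word_scale u powr s) \<le> (\<Sum>u\<in>G. p ^ n * word_scale u powr r)"
  proof (rule sum_mono)
    fix u assume "u \<in> G"
    then have u: "u \<in> lists alphabet" "length u = n" using G by (auto simp: words_def)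
    have "word_scale u powr (s - r) \<le> (q ^ n) powr (s - r)"
      using q(3)[OF u(1)] u(2) word_scale_pos[OF u(1)] \<open>r < s\<close> by (intro powr_mono2) auto
    also have "\<dots> = p ^ n" using q(1) by (simp add: p_def powr_realpow[symmetric] powr_powr mult.commute)
    finally have "word_scale u powr (s - r) * word_scale u powr r \<le> p ^ n * word_scale u powr r"
      by (rule mult_right_mono) simp
    then show "word_scale u powr s \<le> p ^ n * word_scale u powr r" by (simp add: powr_add[symmetric])
  qed
  also have "\<dots> = p ^ n * (\<Sum>u\<in>G. word_scale u powr r)" by (simp add: sum_distrib_left)
  also have "\<dots> \<le> b * (\<Sum>u\<in>G. word_scale u powr r)" using n(1) by (intro mult_right_mono sum_nonneg) auto
  finally have "K powr (- s) / 2 < b * (\<Sum>u\<in>G. word_scale u powr r)" using G(3) by linarith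
  then have "K powr r \<le> (\<Sum>u\<in>G. word_scale u powr r)" using K1 by (simp add: b_def field_simps)
  then show False using positive_if_scale_sum_large[OF K \<open>0 < r\<close> n(2) \<omega>(2) G(1,2)] null by blast
qed

lemma hausdorff_dim_fiber_le:
  assumes "\<omega> \<in> one_sided_shift" "\<omega>' \<in> one_sided_shift"
  shows "hausdorff_dim (fiber_limit_set T Y \<omega>) \<le> hausdorff_dim (fiber_limit_set T Y \<omega>')"
  unfolding hausdorff_dim_def[of "fiber_limit_set T Y \<omega>'"]
proof (rule INF_greatest)
  fix r assume "r \<in> {s. 0 \<le> s \<and> hausdorff_measure s (fiber_limit_set T Y \<omega>') = 0}"
  then have r: "0 \<le> r" "hausdorff_measure r (fiber_limit_set T Y \<omega>') = 0" by auto
  show "hausdorff_dim (fiber_limit_set T Y \<omega>) \<le> ennreal r"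
  proof (rule ennreal_le_epsilon)
    fix e :: real assume "0 < e"
    then have "hausdorff_measure (r + e) (fiber_limit_set T Y \<omega>) = 0"
      using null_in_one_fiber_imp_null_in_all[OF assms r(1) _ r(2)] by simp
    then have "hausdorff_dim (fiber_limit_set T Y \<omega>) \<le> ennreal (r + e)"
      unfolding hausdorff_dim_def using r(1) \<open>0 < e\<close> by (intro INF_lower) auto
    then show "hausdorff_dim (fiber_limit_set T Y \<omega>) \<le> ennreal r + ennreal e"
      using r(1) \<open>0 < e\<close> by simp
  qed
qed

end

theorem theorem4p2:
  fixes Y Ys :: "complex set"
    and T :: "(nat \<Rightarrow> letter) \<Rightarrow> complex \<Rightarrow> complex"
  assumes "conformal_Smale_skew_product Y Ys T"
  shows "\<forall>\<omega>\<in>one_sided_shift. \<forall>\<omega>'\<in>one_sided_shift.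
           hausdorff_dim (fiber_limit_set T Y \<omega>) = hausdorff_dim (fiber_limit_set T Y \<omega>')"
  using conformal_Smale_skew_product.hausdorff_dim_fiber_le[OF assms] by (blast intro: antisym)

end
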